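(* Let $1\le p<\infty$ and let $A=\{\alpha_1,\dots,\alpha_n\}\subseteq\mathcal{P}_p(\mathbb{R}^2)$ be a finite set. Then for every $\epsilon>0$ there exists an $\epsilon$-quasi-isometric embedding $f\colon A\to(\mathcal{D},W_p)$, i.e. a map $f\colon A\to\mathcal{D}$ with $$W_p(\alpha,\beta)-\epsilon\le W_p(f(\alpha),f(\beta))\le W_p(\alpha,\beta)+\epsilon\quad\text{for all }\alpha,\beta\in A.$$
   Context: Throughout $\mathbb{R}^2$ carries the $\ell^\infty$ distance $d(x,y)=\|x-y\|_\infty$. Wasserstein space: for $1\le p<\infty$, $\mathcal{P}_p(\mathbb{R}^2)$ is the set of Borel probability measures on $\mathbb{R}^2$ with finite $p$-th moment, with the metric $W_p(\alpha,\beta)=\left(\inf_{\gamma}\int d(x,y)^p\,d\gamma(x,y)\right)^{1/p}$, where $\gamma$ ranges over Borel probability measures on $\mathbb{R}^2\times\mathbb{R}^2$ with marginals $\alpha$ and $\beta$. Persistence diagrams: let $\mathbb{R}^2_<=\{(b,d)\in\mathbb{R}^2: b<d\}$ and $\Delta_{\mathbb{R}}=\{(x,x): x\in\mathbb{R}\}$. A persistence diagram is a finite multiset of points of $\mathbb{R}^2_<$ (possibly empty); $\mathcal{D}$ is the set of all of them. A partial matching between $D_1,D_2\in\mathcal{D}$ is a triple $(B_1,B_2,f)$ with $B_1\subseteq D_1$, $B_2\subseteq D_2$ (sub-multisets) and $f\colon B_1\to B_2$ a bijection. Its $p$-cost is $$\mathrm{cost}_p(f)=\Big(\sum_{x\in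 B_1}d(x,f(x))^p+\sum_{x\in D_1\setminus B_1}d(x,\Delta_{\mathbb{R}})^p+\sum_{x\in D_2\setminus B_2}d(x,\Delta_{\mathbb{R}})^p\Big)^{1/p}.$$ The $p$-Wasserstein distance $W_p(D_1,D_2)$ is the infimum of $\mathrm{cost}_p(f)$ over all partial matchings between $D_1$ and $D_2$. The symbol $W_p$ is used for both the distance between measures and the distance between diagrams. *)

theory Defs
  imports "HOL-Probability.Probability" "HOL-Library.Multiset"
begin

type_synonym plane = "real \<times> real"

(* The library metric dist on real * real is the Euclidean one, so the l-infinity distance
   needs its own name. Both induce the same Borel sets. *)
definition linf_dist :: "plane \<Rightarrow> plane \<Rightarrow> real" where
  "linf_dist x y = infnorm (x - y)"

lemma linf_dist_eq_max: "linf_dist x y = max \<bar>fst x - fst y\<bar> \<bar>snd x - snd y\<bar>"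
proof -
  have B: "(Basis :: plane set) = {(1, 0), (0, 1)}"
    by (auto simp: Basis_prod_def)
  have "{\<bar>(x - y) \<bullet> b\<bar> |b. b \<in> Basis} = {\<bar>fst x - fst y\<bar>, \<bar>snd x - snd y\<bar>}"
    unfolding setcompr_eq_image Collect_mem_eq B by (simp add: inner_prod_def)
  then show ?thesis
    by (simp add: linf_dist_def infnorm_def cSup_eq_Max)
qed

definition wasserstein_space :: "real \<Rightarrow> plane measure set" where
  "wasserstein_space p =
     {\<alpha>. prob_space \<alpha> \<and> sets \<alpha> = sets borel \<and>
         (\<integral>\<^sup>+ x. ennreal (linf_dist x 0 powr p) \<partial>\<alpha>) < \<infinity>}"

definition couplings :: "plane measure \<Rightarrow> plane measure \<Rightarrow> (plane \<times> plane) measure set" where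
  "couplings \<alpha> \<beta> =
     {\<gamma>. prob_space \<gamma> \<and> sets \<gamma> = sets borel \<and> distr \<gamma> borel fst = \<alpha> \<and> distr \<gamma> borel snd = \<beta>}"

(* The infimum is taken in the extended nonnegative reals. It is finite when both measures lie
   in wasserstein_space p (every coupling then has finite cost, and the product measure is a
   coupling), so enn2real loses nothing there. *)
definition wasserstein_measure :: "real \<Rightarrow> plane measure \<Rightarrow> plane measure \<Rightarrow> real" where
  "wasserstein_measure p \<alpha> \<beta> =
     enn2real (INF \<gamma>\<in>couplings \<alpha> \<beta>. \<integral>\<^sup>+ z. ennreal (linf_dist (fst z) (snd z) powr p) \<partial>\<gamma>)
       powr (1 / p)"

definition diagonal :: "plane set" where
  "diagonal = {(x, x) | x. True}"

definition dist_diagonal :: "plane \<Rightarrow> real" where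
  "dist_diagonal x = (INF y\<in>diagonal. linf_dist x y)"

definition diagrams :: "plane multiset set" where
  "diagrams = {D. \<forall>x\<in>#D. fst x < snd x}"

(* A bijection between multisets matches individual occurrences of points. It is represented by
   its graph F, the multiset of all pairs (x, f x): its two marginals are B1 and B2 exactly when
   every occurrence in B1 is paired with exactly one occurrence in B2 and conversely. *)
definition partial_matchings ::
  "plane multiset \<Rightarrow> plane multiset
     \<Rightarrow> (plane multiset \<times> plane multiset \<times> (plane \<times> plane) multiset) set" where
  "partial_matchings D1 D2 =
     {(B1, B2, F). B1 \<subseteq># D1 \<and> B2 \<subseteq># D2 \<and> image_mset fst F = B1 \<and> image_mset snd F = B2}"

definition matching_cost ::
  "real \<Rightarrow> plane multiset \<Rightarrow> plane multiset
     \<Rightarrow> plane multiset \<times> plane multiset \<times> (plane \<times> plane) multiset \<Rightarrow> real" where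
  "matching_cost p D1 D2 = (\<lambda>(B1, B2, F).
     ((\<Sum>(x, y)\<in>#F. linf_dist x y powr p)
      + (\<Sum>x\<in>#D1 - B1. dist_diagonal x powr p)
      + (\<Sum>x\<in>#D2 - B2. dist_diagonal x powr p)) powr (1 / p))"

definition wasserstein_diagram :: "real \<Rightarrow> plane multiset \<Rightarrow> plane multiset \<Rightarrow> real" where
  "wasserstein_diagram p D1 D2 = (INF m\<in>partial_matchings D1 D2. matching_cost p D1 D2 m)"

end

(* Quantize the plane by a measurable map T with finite range S that moves every measure of A by at
   most eta in W_p; this is possible by dominated convergence. By Minkowski's inequality W_p between
   two measures then differs by at most 2 eta from optimal transport between their cell masses on S:
   a coupling induces a plan on S x S, and a plan lifts to a coupling by spreading each atom as a
   multiple of the product measure over a product of cells.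

   The diagram of a measure takes each point of S with multiplicity floor(N * mass), after shifting S
   far away from the diagonal and scaling it by N^(-1/p). Rounding down a plan gives a partial
   matching that leaves at most (card S)^2 points unmatched on each side. Conversely the multiplicities
   of a partial matching, divided by N, are completed to a plan; because of the shift this costs no
   more than the unmatched points do, up to rounding. All rounding errors vanish as N grows. *)
theory Submission
  imports Defs
begin

section \<open>The l-infinity distance and inequalities between p-th powers\<close>

lemma linf_dist_nonneg [simp]: "0 \<le> linf_dist x y"
  by (simp add: linf_dist_eq_max)

lemma linf_dist_commute: "linf_dist x y = linf_dist y x"
  by (simp add: linf_dist_eq_max abs_minus_commute)

lemma linf_dist_triangle: "linf_dist x z \<le> linf_dist x y + linf_dist y z"
  unfolding linf_dist_def using infnorm_triangle[of "x - y" "y - z"] by simp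

lemma continuous_on_linf_dist: "continuous_on UNIV (\<lambda>z. linf_dist (fst z) (snd z))"
  unfolding linf_dist_eq_max by (intro continuous_intros)

lemma borel_measurable_linf_dist [measurable (raw)]:
  assumes [measurable]: "f \<in> borel_measurable M" "g \<in> borel_measurable M"
  shows "(\<lambda>x. linf_dist (f x) (g x)) \<in> borel_measurable M"
proof -
  have "(\<lambda>z. linf_dist (fst z) (snd z)) \<in> borel_measurable borel"
    by (rule borel_measurable_continuous_onI[OF continuous_on_linf_dist])
  then have "(\<lambda>x. linf_dist (fst (f x, g x)) (snd (f x, g x))) \<in> borel_measurable M"
    by (rule measurable_compose[rotated]) measurable
  then show ?thesis by simp
qed

lemma linf_dist_scaleR: "linf_dist (c *\<^sub>R x) (c *\<^sub>R y) = \<bar>c\<bar> * linf_dist x y"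
  unfolding linf_dist_def by (metis infnorm_mul scaleR_diff_right)

lemma linf_dist_translate: "linf_dist (x + v) (y + v) = linf_dist x y"
  unfolding linf_dist_def by simp

text \<open>Convexity of the p-th power at the points \<open>u / U\<close> and \<open>v / V\<close>
  with weights \<open>U / (U + V)\<close> and \<open>V / (U + V)\<close>. This is the pointwise core
  of Minkowski's inequality: if \<open>u powr p\<close> and \<open>v powr p\<close> have integrals
  at most \<open>U powr p\<close> and \<open>V powr p\<close>, the last factor has integral at most
  1.\<close>

lemma powr_add_le_convex_comb:
  fixes p U V u v :: real
  assumes "1 \<le> p" "0 < U" "0 < V" "0 \<le> u" "0 \<le> v"
  shows "(u + v) powr p \<le>
    (U + V) powr p * (U / (U + V) * (u powr p / U powr p) + V / (U + V) * (v powr p / V powr p))"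
proof -
  define l where "l = V / (U + V)"
  have l: "0 \<le> l" "l \<le> 1" "1 - l = U / (U + V)"
    using assms by (auto simp: l_def field_simps)
  have *: "((1 - l) * x + l * y) powr p \<le> (1 - l) * x powr p + l * y powr p"
    if "0 \<le> x" "0 \<le> y" for x y
  proof -
    \<comment> \<open>Convexity is applied on the open half-line; when an argument is 0, the claim
      reduces to this bound.\<close>
    have small: "(c * z) powr p \<le> c * z powr p" if "0 \<le> c" "c \<le> 1" "0 \<le> z" for c z :: real
    proof -
      have "c powr p \<le> c"
        using powr_mono'[of 1 p c] that assms(1) by simp
      then show ?thesis
        using that by (simp add: powr_mult mult_right_mono)
    qed
    show ?thesis
    proof (cases "x = 0 \<or> y = 0")
      case True
      then show ?thesis
        using small[of l y] small[of "1 - l" x] l that assms(1) by auto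
    next
      case False
      then show ?thesis
        using convex_onD[OF powr_convex[OF assms(1)], of l x y] l that by simp
    qed
  qed
  have "u + v = (U + V) * ((1 - l) * (u / U) + l * (v / V))"
    using assms unfolding l(3) by (simp add: l_def distrib_left)
  also have "\<dots> powr p = (U + V) powr p * ((1 - l) * (u / U) + l * (v / V)) powr p"
    using assms l by (simp add: powr_mult)
  also have "\<dots> \<le> (U + V) powr p * ((1 - l) * (u / U) powr p + l * (v / V) powr p)"
    using assms by (intro mult_left_mono *) auto
  finally show ?thesis
    using assms unfolding l(3) by (simp add: l_def powr_divide)
qed

text \<open>Minkowski's inequality, obtained by integrating the pointwise bound. It is phrased with
  positive bounds \<open>U\<close> and \<open>V\<close> for the two norms, which avoids p-th roots
  of integrals in \<open>ennreal\<close>.\<close>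

lemma nn_integral_powr_add_le:
  fixes f g :: "'a \<Rightarrow> real"
  assumes "1 \<le> p" "0 < U" "0 < V"
    and [measurable]: "f \<in> borel_measurable M" "g \<in> borel_measurable M"
    and "\<And>x. 0 \<le> f x" "\<And>x. 0 \<le> g x"
    and f: "(\<integral>\<^sup>+ x. ennreal (f x powr p) \<partial>M) \<le> ennreal (U powr p)"
    and g: "(\<integral>\<^sup>+ x. ennreal (g x powr p) \<partial>M) \<le> ennreal (V powr p)"
  shows "(\<integral>\<^sup>+ x. ennreal ((f x + g x) powr p) \<partial>M) \<le> ennreal ((U + V) powr p)"
proof -
  define a where "a = (U + V) powr p * (U / (U + V)) / U powr p"
  define b where "b = (U + V) powr p * (V / (U + V)) / V powr p"
  have ab: "0 \<le> a" "0 \<le> b" using assms by (auto simp: a_def b_def)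
  have "(\<integral>\<^sup>+ x. ennreal ((f x + g x) powr p) \<partial>M)
      \<le> (\<integral>\<^sup>+ x. ennreal a * ennreal (f x powr p) + ennreal b * ennreal (g x powr p) \<partial>M)"
  proof (intro nn_integral_mono)
    fix x
    have "(f x + g x) powr p \<le> a * f x powr p + b * g x powr p"
      using powr_add_le_convex_comb[of p U V "f x" "g x"] assms
      by (simp add: a_def b_def algebra_simps)
    then show "ennreal ((f x + g x) powr p)
        \<le> ennreal a * ennreal (f x powr p) + ennreal b * ennreal (g x powr p)"
      using ab by (simp flip: ennreal_mult ennreal_plus)
  qed
  also have "\<dots> = ennreal a * (\<integral>\<^sup>+ x. ennreal (f x powr p) \<partial>M)
      + ennreal b * (\<integral>\<^sup>+ x. ennreal (g x powr p) \<partial>M)"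
    by (simp add: nn_integral_add nn_integral_cmult)
  also have "\<dots> \<le> ennreal a * ennreal (U powr p) + ennreal b * ennreal (V powr p)"
    by (intro add_mono mult_left_mono f g) auto
  also have "\<dots> = ennreal (a * U powr p + b * V powr p)"
    using ab by (simp add: ennreal_mult)
  also have "a * U powr p + b * V powr p = (U + V) powr p * ((U + V) / (U + V))"
    using assms unfolding a_def b_def by (simp flip: add_divide_distrib distrib_left)
  finally show ?thesis using assms by simp
qed

text \<open>The ratios of \<open>u\<close> and \<open>v\<close> to their sum lie in [0, 1], where
  the p-th power is at most the identity. The lemma turns an error \<open>\<delta> powr p\<close> in
  the p-th power of a cost into an error \<delta> of the cost itself.\<close>

lemma powr_add_ge:
  fixes u v p :: real
  assumes "1 \<le> p" "0 \<le> u" "0 \<le> v"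
  shows "u powr p + v powr p \<le> (u + v) powr p"
proof (cases "u + v = 0")
  case True
  then have "u = 0" "v = 0" using assms by linarith+
  then show ?thesis by simp
next
  case False
  define s where "s = u + v"
  have s: "0 < s" using False assms by (simp add: s_def)
  have *: "x powr p \<le> s powr p * (x / s)" if "0 \<le> x" "x \<le> s" for x
  proof -
    have "x powr p = s powr p * (x / s) powr p"
      using that s by (simp add: powr_divide)
    also have "\<dots> \<le> s powr p * (x / s)"
      using powr_mono'[of 1 p "x / s"] that s assms(1) by (intro mult_left_mono) auto
    finally show ?thesis .
  qed
  have "u powr p + v powr p \<le> s powr p * (u / s) + s powr p * (v / s)"
    using assms by (intro add_mono *) (auto simp: s_def)
  also have "\<dots> = s powr p"
    using s by (simp add: s_def flip: add_divide_distrib distrib_left)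
  finally show ?thesis by (simp add: s_def)
qed

section \<open>Transport plans between weights and matchings of rounded multisets\<close>

text \<open>The conditions concern values on \<open>S\<close> only; elsewhere a plan is arbitrary,
  so a plan is carried to another set of points by composing functions.\<close>

definition transport_plans ::
  "'a set \<Rightarrow> ('a \<Rightarrow> real) \<Rightarrow> ('a \<Rightarrow> real) \<Rightarrow> ('a \<Rightarrow> 'a \<Rightarrow> real) set" where
  "transport_plans S a b =
     {w. (\<forall>s\<in>S. \<forall>t\<in>S. 0 \<le> w s t) \<and> (\<forall>s\<in>S. (\<Sum>t\<in>S. w s t) = a s) \<and>
         (\<forall>t\<in>S. (\<Sum>s\<in>S. w s t) = b t)}"

definition transport_cost :: "real \<Rightarrow> plane set \<Rightarrow> (plane \<Rightarrow> plane \<Rightarrow> real) \<Rightarrow> real" where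
  "transport_cost p S w = (\<Sum>s\<in>S. \<Sum>t\<in>S. w s t * linf_dist s t powr p)"

text \<open>Rounding down is compatible with marginals: a sum of floors is at most the floor of the
  sum. So a plan rounded by the same definition on \<open>S \<times> S\<close> matches sub-multisets
  of the rounded weights.\<close>

definition sample :: "nat \<Rightarrow> 'a set \<Rightarrow> ('a \<Rightarrow> real) \<Rightarrow> 'a multiset" where
  "sample N S a = (\<Sum>s\<in>S. replicate_mset (nat \<lfloor>real N * a s\<rfloor>) s)"

lemma transport_plansD:
  assumes "w \<in> transport_plans S a b"
  shows "s \<in> S \<Longrightarrow> t \<in> S \<Longrightarrow> 0 \<le> w s t"
    and "s \<in> S \<Longrightarrow> (\<Sum>t\<in>S. w s t) = a s"
    and "t \<in> S \<Longrightarrow> (\<Sum>s\<in>S. w s t) = b t"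
  using assms by (auto simp: transport_plans_def)

lemma transport_cost_nonneg:
  assumes "w \<in> transport_plans S a b"
  shows "0 \<le> transport_cost p S w"
  unfolding transport_cost_def using transport_plansD(1)[OF assms]
  by (intro sum_nonneg mult_nonneg_nonneg) auto

lemma count_sample:
  assumes "finite S"
  shows "count (sample N S a) x = (if x \<in> S then nat \<lfloor>real N * a x\<rfloor> else 0)"
  using assms by (simp add: sample_def count_sum if_distrib sum.delta cong: if_cong)

lemma set_mset_sample:
  assumes "finite S"
  shows "set_mset (sample N S a) \<subseteq> S"
  using assms by (auto simp: count_sample simp flip: count_greater_zero_iff split: if_splits)

lemma sum_mset_eq_sum_count:
  fixes g :: "'a \<Rightarrow> real"
  assumes "finite S" "set_mset D \<subseteq> S"
  shows "(\<Sum>x\<in>#D. g x) = (\<Sum>x\<in>S. real (count D x) * g x)"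
  using assms(2)
proof (induction D)
  case (add y D)
  have "(\<Sum>x\<in>S. real (count (add_mset y D) x) * g x)
      = (\<Sum>x\<in>S. real (count D x) * g x + (if x = y then g x else 0))"
    by (intro sum.cong) (auto simp: algebra_simps)
  then show ?case using add assms(1) by (simp add: sum.distrib)
qed simp

lemma size_eq_sum_count:
  assumes "finite S" "set_mset D \<subseteq> S"
  shows "real (size D) = (\<Sum>x\<in>S. real (count D x))"
  using sum_mset_eq_sum_count[OF assms, of "\<lambda>_. 1"] by simp

lemma count_image_fst:
  assumes "finite S" "set_mset F \<subseteq> S \<times> S"
  shows "count (image_mset fst F) s = (\<Sum>t\<in>S. count F (s, t))"
  using assms(2)
proof (induction F)
  case (add z F)
  obtain x y where z: "z = (x, y)" by (cases z)
  have "(\<Sum>t\<in>S. count (add_mset z F) (s, t))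
      = (\<Sum>t\<in>S. count F (s, t) + (if t = y then (if s = x then 1 else 0) else 0))"
    by (intro sum.cong) (auto simp: z)
  then show ?case using add assms(1) by (simp add: sum.distrib z)
qed simp

lemma count_image_snd:
  assumes "finite S" "set_mset F \<subseteq> S \<times> S"
  shows "count (image_mset snd F) t = (\<Sum>s\<in>S. count F (s, t))"
  using assms(2)
proof (induction F)
  case (add z F)
  obtain x y where z: "z = (x, y)" by (cases z)
  have "(\<Sum>s\<in>S. count (add_mset z F) (s, t))
      = (\<Sum>s\<in>S. count F (s, t) + (if s = x then (if t = y then 1 else 0) else 0))"
    by (intro sum.cong) (auto simp: z)
  then show ?case using add assms(1) by (simp add: sum.distrib z)
qed simp

lemma sum_mset_nonneg:
  fixes g :: "'a \<Rightarrow> real"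
  assumes "\<And>x. 0 \<le> g x"
  shows "0 \<le> (\<Sum>x\<in>#D. g x)"
  using assms by (induction D) auto

lemma matching_cost_powr:
  assumes "1 \<le> p"
  shows "matching_cost p D1 D2 (B1, B2, F) powr p =
     (\<Sum>(x, y)\<in>#F. linf_dist x y powr p)
      + (\<Sum>x\<in>#D1 - B1. dist_diagonal x powr p)
      + (\<Sum>x\<in>#D2 - B2. dist_diagonal x powr p)"
proof -
  have "0 \<le> (\<Sum>(x, y)\<in>#F. linf_dist x y powr p)
      + (\<Sum>x\<in>#D1 - B1. dist_diagonal x powr p)
      + (\<Sum>x\<in>#D2 - B2. dist_diagonal x powr p)"
    by (intro add_nonneg_nonneg sum_mset_nonneg) auto
  then show ?thesis
    using assms by (simp add: matching_cost_def powr_powr)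
qed

text \<open>The mass left over by a partial matching, rounding losses included, has equal totals on both
  sides, so it can be redistributed by a multiple of the product of the two leftovers.\<close>

lemma matching_to_transport_plan:
  assumes p: "1 \<le> p" and S: "finite S" and N: "0 < N"
    and a: "\<And>s. s \<in> S \<Longrightarrow> 0 \<le> a s" "sum a S = 1"
    and b: "\<And>s. s \<in> S \<Longrightarrow> 0 \<le> b s" "sum b S = 1"
    and C: "0 \<le> C" "\<And>s t. s \<in> S \<Longrightarrow> t \<in> S \<Longrightarrow> linf_dist s t powr p \<le> C"
      "\<And>s. s \<in> S \<Longrightarrow> C \<le> dist_diagonal s powr p"
    and m: "m \<in> partial_matchings (sample N S a) (sample N S b)"
  shows "\<exists>w\<in>transport_plans S a b. real N * transport_cost p S w
    \<le> matching_cost p (sample N S a) (sample N S b) m powr p + C * real (card S)"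
proof -
  let ?D1 = "sample N S a" and ?D2 = "sample N S b"
  obtain B1 B2 F where mF: "m = (B1, B2, F)" by (cases m)
  have B: "B1 \<subseteq># ?D1" "B2 \<subseteq># ?D2" "B1 = image_mset fst F" "B2 = image_mset snd F"
    using m by (auto simp: partial_matchings_def mF)
  have BS: "set_mset B1 \<subseteq> S" "set_mset B2 \<subseteq> S"
    using set_mset_mono[OF B(1)] set_mset_mono[OF B(2)] set_mset_sample[OF S] by blast+
  have FS: "set_mset F \<subseteq> S \<times> S"
  proof
    fix z assume "z \<in># F"
    then have "fst z \<in># B1" "snd z \<in># B2" unfolding B(3,4) by auto
    then show "z \<in> S \<times> S" using BS by (cases z) auto
  qed
  \<comment> \<open>\<open>w0\<close> is the mass moved by matched pairs; \<open>r\<close> and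
    \<open>q\<close> are the masses left over on the two sides. Both leftovers total
    \<open>R\<close>, since both weights have sum 1 and \<open>B1\<close> and \<open>B2\<close> both
    have the size of \<open>F\<close>.\<close>
  define w0 where "w0 s t = real (count F (s, t)) / real N" for s t
  define r where "r s = a s - real (count B1 s) / real N" for s
  define q where "q t = b t - real (count B2 t) / real N" for t
  define R where "R = 1 - real (size F) / real N"
  have w0r: "(\<Sum>t\<in>S. w0 s t) = a s - r s" for s
    unfolding w0_def r_def B(3) count_image_fst[OF S FS] by (simp add: sum_divide_distrib)
  have w0q: "(\<Sum>s\<in>S. w0 s t) = b t - q t" for t
    unfolding w0_def q_def B(4) count_image_snd[OF S FS] by (simp add: sum_divide_distrib)
  have floor: "real (count B s) \<le> real N * c s"
    if "B \<subseteq># sample N S c" "s \<in> S" "0 \<le> c s" for B c s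
  proof -
    have "count B s \<le> nat \<lfloor>real N * c s\<rfloor>"
      using mset_subset_eq_count[OF that(1), of s] that(2) by (simp add: count_sample[OF S])
    then have "real (count B s) \<le> real (nat \<lfloor>real N * c s\<rfloor>)" by linarith
    also have "\<dots> \<le> real N * c s" using that(3) by simp
    finally show ?thesis .
  qed
  have r0: "0 \<le> r s" if "s \<in> S" for s
    using floor[OF B(1) that a(1)[OF that]] N by (simp add: r_def field_simps)
  have q0: "0 \<le> q s" if "s \<in> S" for s
    using floor[OF B(2) that b(1)[OF that]] N by (simp add: q_def field_simps)
  have sr: "sum r S = R"
    using size_eq_sum_count[OF S BS(1)]
    by (simp add: r_def R_def sum_subtractf a(2) B(3) flip: sum_divide_distrib)
  have sq: "sum q S = R"
    using size_eq_sum_count[OF S BS(2)]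
    by (simp add: q_def R_def sum_subtractf b(2) B(4) flip: sum_divide_distrib)
  have R0: "0 \<le> R" unfolding sr[symmetric] by (intro sum_nonneg r0)
  \<comment> \<open>For \<open>R = 0\<close> the quotient is 0, and so is every leftover, being a
    nonnegative term of a sum equal to 0. Hence the formula for \<open>w\<close> covers this case as
    well.\<close>
  have rz: "r s * R / R = r s" if "s \<in> S" for s
  proof (cases "R = 0")
    case True
    then have "r s = 0" using sum_nonneg_eq_0_iff[OF S r0] sr that by simp
    then show ?thesis by simp
  qed simp
  have qz: "R * q s / R = q s" if "s \<in> S" for s
  proof (cases "R = 0")
    case True
    then have "q s = 0" using sum_nonneg_eq_0_iff[OF S q0] sq that by simp
    then show ?thesis by simp
  qed simp
  define w where "w s t = w0 s t + r s * q t / R" for s t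
  have w: "w \<in> transport_plans S a b"
    unfolding transport_plans_def
  proof (safe)
    fix s t assume "s \<in> S" "t \<in> S"
    then show "0 \<le> w s t" using r0 q0 R0 by (simp add: w_def w0_def)
  next
    fix s assume s: "s \<in> S"
    have "(\<Sum>t\<in>S. w s t) = a s - r s + r s * R / R"
      by (simp add: w_def sum.distrib w0r flip: sum_divide_distrib sum_distrib_left sq)
    then show "(\<Sum>t\<in>S. w s t) = a s" using rz[OF s] by simp
  next
    fix t assume t: "t \<in> S"
    have "(\<Sum>s\<in>S. w s t) = b t - q t + R * q t / R"
      by (simp add: w_def sum.distrib w0q flip: sum_divide_distrib sum_distrib_right sr)
    then show "(\<Sum>s\<in>S. w s t) = b t" using qz[OF t] by simp
  qed
  have matched: "real N * (\<Sum>s\<in>S. \<Sum>t\<in>S. w0 s t * linf_dist s t powr p)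
      = (\<Sum>(x, y)\<in>#F. linf_dist x y powr p)"
    using N sum_mset_eq_sum_count[OF _ FS, of "\<lambda>(x, y). linf_dist x y powr p"] S
    by (simp add: sum.cartesian_product w0_def sum_distrib_left case_prod_unfold)
  have "(\<Sum>s\<in>S. \<Sum>t\<in>S. r s * q t / R * linf_dist s t powr p)
      \<le> (\<Sum>s\<in>S. \<Sum>t\<in>S. r s * q t / R * C)"
    using r0 q0 R0 by (intro sum_mono mult_left_mono C) auto
  also have "\<dots> = (\<Sum>s\<in>S. \<Sum>t\<in>S. r s * q t) / R * C"
    by (simp add: sum_divide_distrib sum_distrib_right)
  also have "(\<Sum>s\<in>S. \<Sum>t\<in>S. r s * q t) = R * R"
    using sum_product[of r S q S] sr sq by simp
  also have "R * R / R * C = C * R" by simp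
  finally have "real N * (\<Sum>s\<in>S. \<Sum>t\<in>S. r s * q t / R * linf_dist s t powr p) \<le> real N * (C * R)"
    by (intro mult_left_mono) auto
  also have "\<dots> = C * (real N * R)" by simp
  also have "real N * R = (\<Sum>s\<in>S. real N * a s - real (count B1 s))"
    using N by (simp add: sum_distrib_left r_def right_diff_distrib flip: sr)
  \<comment> \<open>\<open>N * a s\<close> exceeds the multiplicity of \<open>s\<close> in the first
    diagram by at most 1, so \<open>N * R\<close> is at most the number of unmatched points there
    plus \<open>card S\<close>.\<close>
  also have "\<dots> \<le> (\<Sum>s\<in>S. real (count (?D1 - B1) s) + 1)"
  proof (intro sum_mono)
    fix s assume s: "s \<in> S"
    have "count B1 s \<le> count ?D1 s" using mset_subset_eq_count[OF B(1)] .
    moreover have "real N * a s \<le> real (count ?D1 s) + 1"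
      using s a(1)[OF s] by (simp add: count_sample[OF S])
    ultimately show "real N * a s - real (count B1 s) \<le> real (count (?D1 - B1) s) + 1"
      by (simp add: of_nat_diff)
  qed
  also have "\<dots> = real (size (?D1 - B1)) + real (card S)"
    using set_mset_sample[OF S, of N a]
    by (subst size_eq_sum_count[OF S]) (auto simp: sum.distrib dest: in_diffD)
  finally have "real N * (\<Sum>s\<in>S. \<Sum>t\<in>S. r s * q t / R * linf_dist s t powr p)
      \<le> C * real (size (?D1 - B1)) + C * real (card S)"
    using C(1) by (simp add: distrib_left mult_left_mono)
  \<comment> \<open>Leaving a point unmatched costs at least \<open>C\<close>, so the unmatched
    points of the first diagram already pay for the redistribution; those of the second enter only
    as a nonnegative term.\<close>
  moreover have "C * real (size (?D1 - B1)) \<le> (\<Sum>x\<in>#?D1 - B1. dist_diagonal x powr p)"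
  proof -
    have "(\<Sum>x\<in>#?D1 - B1. C) \<le> (\<Sum>x\<in>#?D1 - B1. dist_diagonal x powr p)"
      using set_mset_sample[OF S, of N a] by (intro sum_mset_mono C(3)) (auto dest: in_diffD)
    then show ?thesis by (simp add: mult.commute)
  qed
  moreover have "real N * transport_cost p S w =
      real N * (\<Sum>s\<in>S. \<Sum>t\<in>S. w0 s t * linf_dist s t powr p) +
      real N * (\<Sum>s\<in>S. \<Sum>t\<in>S. r s * q t / R * linf_dist s t powr p)"
    by (simp add: transport_cost_def w_def distrib_right sum.distrib flip: distrib_left)
  moreover have "0 \<le> (\<Sum>x\<in>#?D2 - B2. dist_diagonal x powr p)"
    by (intro sum_mset_nonneg) auto
  ultimately have "real N * transport_cost p S w
      \<le> matching_cost p ?D1 ?D2 m powr p + C * real (card S)"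
    unfolding mF matching_cost_powr[OF p] matched by linarith
  with w show ?thesis by blast
qed

text \<open>Round every entry of \<open>N * w\<close> down. Each entry loses at most 1, so at least
  \<open>N\<close> minus the square of \<open>card S\<close> pairs are matched, while each diagram
  has at most \<open>N\<close> points. The factor 2 counts the unmatched points of both sides, each
  of cost at most \<open>H\<close>.\<close>

lemma transport_plan_to_matching:
  assumes p: "1 \<le> p" and S: "finite S"
    and a: "sum a S = 1" and b: "sum b S = 1"
    and H: "\<And>s. s \<in> S \<Longrightarrow> dist_diagonal s powr p \<le> H" and "0 \<le> H"
    and w: "w \<in> transport_plans S a b"
  shows "\<exists>m\<in>partial_matchings (sample N S a) (sample N S b).
    matching_cost p (sample N S a) (sample N S b) m powr p
      \<le> real N * transport_cost p S w + 2 * (H * (real (card S))\<^sup>2)"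
proof -
  let ?D1 = "sample N S a" and ?D2 = "sample N S b"
  define F where "F = sample N (S \<times> S) (\<lambda>(s, t). w s t)"
  have SS: "finite (S \<times> S)" using S by simp
  have FS: "set_mset F \<subseteq> S \<times> S" unfolding F_def by (rule set_mset_sample[OF SS])
  have cF: "count F (s, t) = nat \<lfloor>real N * w s t\<rfloor>" if "s \<in> S" "t \<in> S" for s t
    using that by (simp add: F_def count_sample[OF SS])
  have le: "real (count F (s, t)) \<le> real N * w s t" if "s \<in> S" "t \<in> S" for s t
    using transport_plansD(1)[OF w that] by (simp add: cF[OF that])
  have B1: "image_mset fst F \<subseteq># ?D1"
  proof (rule mset_subset_eqI)
    fix s
    show "count (image_mset fst F) s \<le> count ?D1 s"
    proof (cases "s \<in> S")
      case True
      have "real (\<Sum>t\<in>S. count F (s, t)) \<le> (\<Sum>t\<in>S. real N * w s t)"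
        unfolding of_nat_sum by (intro sum_mono le True)
      also have "\<dots> = real N * a s"
        using transport_plansD(2)[OF w True] by (simp flip: sum_distrib_left)
      finally show ?thesis
        using True by (simp add: count_image_fst[OF S FS] count_sample[OF S] le_nat_floor)
    next
      case False
      then have "s \<notin># image_mset fst F" using FS by auto
      then have "count (image_mset fst F) s = 0" unfolding not_in_iff .
      then show ?thesis by simp
    qed
  qed
  have B2: "image_mset snd F \<subseteq># ?D2"
  proof (rule mset_subset_eqI)
    fix t
    show "count (image_mset snd F) t \<le> count ?D2 t"
    proof (cases "t \<in> S")
      case True
      have "real (\<Sum>s\<in>S. count F (s, t)) \<le> (\<Sum>s\<in>S. real N * w s t)"
        unfolding of_nat_sum by (intro sum_mono le True)
      also have "\<dots> = real N * b t"
        using transport_plansD(3)[OF w True] by (simp flip: sum_distrib_left)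
      finally show ?thesis
        using True by (simp add: count_image_snd[OF S FS] count_sample[OF S] le_nat_floor)
    next
      case False
      then have "t \<notin># image_mset snd F" using FS by auto
      then have "count (image_mset snd F) t = 0" unfolding not_in_iff .
      then show ?thesis by simp
    qed
  qed
  have "real N = (\<Sum>s\<in>S. \<Sum>t\<in>S. real N * w s t)"
    using a transport_plansD(2)[OF w] by (simp flip: sum_distrib_left)
  also have "\<dots> \<le> (\<Sum>s\<in>S. \<Sum>t\<in>S. real (count F (s, t)) + 1)"
    using transport_plansD(1)[OF w] by (intro sum_mono) (simp add: cF)
  also have "\<dots> = real (size F) + (real (card S))\<^sup>2"
    unfolding size_eq_sum_count[OF SS FS]
    by (simp add: sum.distrib sum.cartesian_product case_prod_unfold power2_eq_square)
  finally have sizeF: "real N \<le> real (size F) + (real (card S))\<^sup>2" .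
  have unmatched: "(\<Sum>x\<in>#sample N S c - B. dist_diagonal x powr p) \<le> H * (real (card S))\<^sup>2"
    if B: "B \<subseteq># sample N S c" "size B = size F" and c: "sum c S = 1" "\<And>s. s \<in> S \<Longrightarrow> 0 \<le> c s"
    for B c
  proof -
    have "real (size (sample N S c)) \<le> (\<Sum>s\<in>S. real N * c s)"
      unfolding size_eq_sum_count[OF S set_mset_sample[OF S]]
      using c(2) by (intro sum_mono) (simp add: count_sample[OF S])
    also have "\<dots> = real N" using c(1) by (simp flip: sum_distrib_left)
    finally have "real (size (sample N S c)) - real (size F) \<le> (real (card S))\<^sup>2"
      using sizeF by linarith
    moreover have "real (size (sample N S c - B)) = real (size (sample N S c)) - real (size F)"
      using size_mset_mono[OF B(1)] by (simp add: size_Diff_submset[OF B(1)] B(2) of_nat_diff)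
    ultimately have "real (size (sample N S c - B)) \<le> (real (card S))\<^sup>2" by linarith
    moreover have "(\<Sum>x\<in>#sample N S c - B. dist_diagonal x powr p) \<le> (\<Sum>x\<in>#sample N S c - B. H)"
      using set_mset_sample[OF S, of N c] by (intro sum_mset_mono H) (auto dest: in_diffD)
    ultimately show ?thesis
      using mult_left_mono[of "real (size (sample N S c - B))" "(real (card S))\<^sup>2" H] \<open>0 \<le> H\<close>
      by (simp add: mult.commute)
  qed
  have a0: "0 \<le> a s" if "s \<in> S" for s
    unfolding transport_plansD(2)[OF w that, symmetric]
    using transport_plansD(1)[OF w] that by (intro sum_nonneg)
  have b0: "0 \<le> b t" if "t \<in> S" for t
    unfolding transport_plansD(3)[OF w that, symmetric]
    using transport_plansD(1)[OF w] that by (intro sum_nonneg)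
  have "(\<Sum>(x, y)\<in>#F. linf_dist x y powr p)
      = (\<Sum>s\<in>S. \<Sum>t\<in>S. real (count F (s, t)) * linf_dist s t powr p)"
    unfolding sum_mset_eq_sum_count[OF SS FS]
    by (simp add: sum.cartesian_product case_prod_unfold)
  also have "\<dots> \<le> (\<Sum>s\<in>S. \<Sum>t\<in>S. (real N * w s t) * linf_dist s t powr p)"
    by (intro sum_mono mult_right_mono le) auto
  also have "\<dots> = real N * transport_cost p S w"
    by (simp add: transport_cost_def sum_distrib_left mult.assoc)
  finally have "matching_cost p ?D1 ?D2 (image_mset fst F, image_mset snd F, F) powr p
      \<le> real N * transport_cost p S w + 2 * (H * (real (card S))\<^sup>2)"
    using unmatched[OF B1 _ a a0] unmatched[OF B2 _ b b0]
    unfolding matching_cost_powr[OF p] by simp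
  moreover have "(image_mset fst F, image_mset snd F, F) \<in> partial_matchings ?D1 ?D2"
    using B1 B2 by (simp add: partial_matchings_def)
  ultimately show ?thesis by blast
qed

section \<open>Quantized couplings\<close>

text \<open>A finite sum of indicators of the fibres of \<open>X\<close> represents
  \<open>g (X x)\<close> for arbitrary \<open>g\<close>, so measurability is asked of the
  fibres.\<close>

lemma nn_integral_finite_range:
  fixes g :: "'b \<Rightarrow> ennreal"
  assumes S: "finite S" and X: "\<And>x. X x \<in> S"
    and meas: "\<And>s. s \<in> S \<Longrightarrow> {x \<in> space M. X x = s} \<in> sets M"
  shows "(\<integral>\<^sup>+ x. g (X x) \<partial>M) = (\<Sum>s\<in>S. g s * emeasure M {x \<in> space M. X x = s})"
proof -
  have "(\<integral>\<^sup>+ x. g (X x) \<partial>M)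
      = (\<integral>\<^sup>+ x. (\<Sum>s\<in>S. g s * indicator {x \<in> space M. X x = s} x) \<partial>M)"
  proof (intro nn_integral_cong)
    fix x assume "x \<in> space M"
    then have "(\<Sum>s\<in>S. g s * indicator {x \<in> space M. X x = s} x)
        = (\<Sum>s\<in>S. if X x = s then g s else 0)"
      by (intro sum.cong) (auto simp: indicator_def)
    then show "g (X x) = (\<Sum>s\<in>S. g s * indicator {x \<in> space M. X x = s} x)"
      using S X by simp
  qed
  also have "\<dots> = (\<Sum>s\<in>S. g s * emeasure M {x \<in> space M. X x = s})"
    using meas by (simp add: nn_integral_sum nn_integral_cmult_indicator)
  finally show ?thesis .
qed

lemma (in prob_space) sum_prob_fibres:
  assumes "finite S" "\<And>x. X x \<in> S" "\<And>s. s \<in> S \<Longrightarrow> {x \<in> space M. X x = s} \<in> events"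
  shows "(\<Sum>s\<in>S. prob {x \<in> space M. X x = s}) = 1"
proof -
  have "prob (\<Union>s\<in>S. {x \<in> space M. X x = s}) = (\<Sum>s\<in>S. prob {x \<in> space M. X x = s})"
    using assms by (intro finite_measure_finite_Union) (auto simp: disjoint_family_on_def)
  moreover have "(\<Union>s\<in>S. {x \<in> space M. X x = s}) = space M" using assms(2) by auto
  ultimately show ?thesis by (simp add: prob_space)
qed

text \<open>The cost, before taking the p-th root, of the coupling that moves every point
  \<open>x\<close> of \<alpha> to \<open>T x\<close>. It bounds the p-th power of the distance
  between \<alpha> and its image under \<open>T\<close>.\<close>

definition quantization_error :: "real \<Rightarrow> (plane \<Rightarrow> plane) \<Rightarrow> plane measure \<Rightarrow> ennreal" where
  "quantization_error p T \<alpha> = (\<integral>\<^sup>+ x. ennreal (linf_dist x (T x) powr p) \<partial>\<alpha>)"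

definition cell_mass :: "('a \<Rightarrow> 'b) \<Rightarrow> 'a measure \<Rightarrow> 'b \<Rightarrow> real" where
  "cell_mass T \<alpha> s = measure \<alpha> {x \<in> space \<alpha>. T x = s}"

locale quantizer =
  fixes S :: "plane set" and T :: "plane \<Rightarrow> plane"
  assumes finite_S: "finite S" and range_T: "T x \<in> S" and measurable_T: "T \<in> borel_measurable borel"
begin

text \<open>A measurable map with finite range is a simple function, and simple functions can be
  composed with any \<open>g\<close>.\<close>

lemma borel_measurable_comp_T:
  fixes g :: "plane \<Rightarrow> 'b::topological_space"
  assumes f: "f \<in> borel_measurable M"
  shows "(\<lambda>x. g (T (f x))) \<in> borel_measurable M"
proof -
  have sf: "simple_function borel T"
    using measurable_T finite_S range_T
    by (auto intro!: simple_function_borel_measurable intro: finite_subset[of _ S])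
  have "simple_function borel (\<lambda>x. g (T x))"
    using simple_function_compose[OF sf, of g] by (simp add: o_def)
  then have "(\<lambda>x. g (T x)) \<in> borel_measurable borel" by (rule borel_measurable_simple_function)
  then show ?thesis by (rule measurable_compose[OF f])
qed

text \<open>The pair of quantized points is again a simple function, with values in
  \<open>S \<times> S\<close>. This makes the piecewise constant density in
  \<open>transport_plan_to_coupling\<close> measurable.\<close>

lemma borel_measurable_comp_T2:
  fixes g :: "plane \<Rightarrow> plane \<Rightarrow> 'b::topological_space"
  assumes f: "f \<in> borel_measurable M" and h: "h \<in> borel_measurable M"
  shows "(\<lambda>x. g (T (f x)) (T (h x))) \<in> borel_measurable M"
proof -
  have "(\<lambda>x. T (f x)) \<in> borel_measurable M" "(\<lambda>x. T (h x)) \<in> borel_measurable M"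
    using borel_measurable_comp_T[OF f, of id] borel_measurable_comp_T[OF h, of id] by auto
  then have pair: "(\<lambda>x. (T (f x), T (h x))) \<in> borel_measurable M"
    by (rule borel_measurable_Pair)
  have "(\<lambda>x. (T (f x), T (h x))) ` space M \<subseteq> S \<times> S"
    using range_T by blast
  then have "simple_function M (\<lambda>x. (T (f x), T (h x)))"
    by (intro simple_function_borel_measurable pair
        finite_subset[OF _ finite_cartesian_product[OF finite_S finite_S]])
  from borel_measurable_simple_function[OF simple_function_compose[OF this, of "case_prod g"]]
  show ?thesis by (simp add: o_def)
qed

lemma sets_cell: "{x. T x = s} \<in> sets borel"
  using measurable_sets[OF measurable_T, of "{s}"] by (simp add: vimage_def)

lemma nn_integral_T:
  assumes "prob_space \<alpha>" "sets \<alpha> = sets borel"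
  shows "(\<integral>\<^sup>+ x. g (T x) \<partial>\<alpha>) = (\<Sum>s\<in>S. g s * ennreal (cell_mass T \<alpha> s))"
proof -
  interpret prob_space \<alpha> by fact
  have "space \<alpha> = UNIV" using sets_eq_imp_space_eq[OF assms(2)] by simp
  then show ?thesis
    using nn_integral_finite_range[OF finite_S range_T, where M = \<alpha> and g = g] sets_cell assms(2)
    by (simp add: cell_mass_def emeasure_eq_measure)
qed

lemma sum_cell_mass:
  assumes "prob_space \<alpha>" "sets \<alpha> = sets borel"
  shows "sum (cell_mass T \<alpha>) S = 1"
proof -
  interpret prob_space \<alpha> by fact
  have "space \<alpha> = UNIV" using sets_eq_imp_space_eq[OF assms(2)] by simp
  then show ?thesis
    using sum_prob_fibres[OF finite_S range_T] sets_cell assms(2) by (simp add: cell_mass_def)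
qed

text \<open>There are finitely many cells, so those of mass 0 together form a null set. This permits
  division by cell masses inside integrals.\<close>

lemma AE_cell_mass_pos:
  assumes "prob_space \<alpha>" "sets \<alpha> = sets borel"
  shows "AE x in \<alpha>. 0 < cell_mass T \<alpha> (T x)"
proof -
  interpret prob_space \<alpha> by fact
  have sp: "space \<alpha> = UNIV" using sets_eq_imp_space_eq[OF assms(2)] by simp
  have "AE x in \<alpha>. \<forall>s\<in>S. T x = s \<longrightarrow> 0 < cell_mass T \<alpha> s"
  proof (rule AE_finite_allI[OF finite_S])
    fix s assume "s \<in> S"
    show "AE x in \<alpha>. T x = s \<longrightarrow> 0 < cell_mass T \<alpha> s"
    proof (cases "0 < cell_mass T \<alpha> s")
      case False
      then have "emeasure \<alpha> {x. T x = s} = 0"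
        by (simp add: cell_mass_def sp emeasure_eq_measure measure_le_0_iff not_less)
      then have "AE x in \<alpha>. \<not> T x = s"
        by (intro AE_I[of _ _ "{x. T x = s}"]) (auto simp: sets_cell assms(2))
      then show ?thesis by eventually_elim simp
    qed simp
  qed
  then show ?thesis by eventually_elim (use range_T in auto)
qed

text \<open>Each of the two displacements depends on one coordinate only, so its integral is the
  quantization error of a marginal; Minkowski's inequality adds the two.\<close>

lemma nn_integral_coupling_error:
  assumes p: "1 \<le> p" and \<eta>: "0 < \<eta>" and \<gamma>: "\<gamma> \<in> couplings \<alpha> \<beta>"
    and "quantization_error p T \<alpha> \<le> ennreal (\<eta> powr p)"
    and "quantization_error p T \<beta> \<le> ennreal (\<eta> powr p)"
  shows "(\<integral>\<^sup>+ z. ennreal ((linf_dist (fst z) (T (fst z)) + linf_dist (snd z) (T (snd z))) powr p) \<partial>\<gamma>)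
    \<le> ennreal ((\<eta> + \<eta>) powr p)"
proof -
  note [measurable] = measurable_T
  have [measurable_cong]: "sets \<gamma> = sets borel"
    and marg: "distr \<gamma> borel fst = \<alpha>" "distr \<gamma> borel snd = \<beta>"
    using \<gamma> by (auto simp: couplings_def)
  have [measurable]: "(fst :: plane \<times> plane \<Rightarrow> plane) \<in> borel_measurable borel"
    "(snd :: plane \<times> plane \<Rightarrow> plane) \<in> borel_measurable borel"
    by (auto intro!: borel_measurable_continuous_onI continuous_intros)
  have "(\<integral>\<^sup>+ z. ennreal (linf_dist (fst z) (T (fst z)) powr p) \<partial>\<gamma>) = quantization_error p T \<alpha>"
    "(\<integral>\<^sup>+ z. ennreal (linf_dist (snd z) (T (snd z)) powr p) \<partial>\<gamma>) = quantization_error p T \<beta>"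
    unfolding quantization_error_def marg[symmetric] by (simp_all add: nn_integral_distr)
  then show ?thesis
    using assms by (intro nn_integral_powr_add_le[OF p \<eta> \<eta>]) auto
qed

text \<open>Push \<gamma> forward under \<open>T\<close> in both coordinates. The quantized distance
  exceeds the original one by at most the two displacements, so Minkowski's inequality adds
  \<open>2 * \<eta>\<close> to the bound.\<close>

lemma coupling_to_transport_plan:
  assumes p: "1 \<le> p" and \<eta>: "0 < \<eta>" and U: "0 < U" and \<gamma>: "\<gamma> \<in> couplings \<alpha> \<beta>"
    and err: "quantization_error p T \<alpha> \<le> ennreal (\<eta> powr p)"
      "quantization_error p T \<beta> \<le> ennreal (\<eta> powr p)"
    and cost: "(\<integral>\<^sup>+ z. ennreal (linf_dist (fst z) (snd z) powr p) \<partial>\<gamma>) \<le> ennreal (U powr p)"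
  shows "\<exists>w\<in>transport_plans S (cell_mass T \<alpha>) (cell_mass T \<beta>).
    transport_cost p S w \<le> (U + 2 * \<eta>) powr p"
proof -
  note [measurable] = measurable_T
  have sets: "sets \<gamma> = sets borel" and marg: "distr \<gamma> borel fst = \<alpha>" "distr \<gamma> borel snd = \<beta>"
    using \<gamma> by (auto simp: couplings_def)
  note [measurable_cong] = sets
  have sp: "space \<gamma> = UNIV" using sets_eq_imp_space_eq[OF sets] by simp
  interpret prob_space \<gamma> using \<gamma> by (simp add: couplings_def)
  have [measurable]: "(fst :: plane \<times> plane \<Rightarrow> plane) \<in> borel_measurable borel"
    "(snd :: plane \<times> plane \<Rightarrow> plane) \<in> borel_measurable borel"
    by (auto intro!: borel_measurable_continuous_onI continuous_intros)
  define w where "w s t = prob {z. T (fst z) = s \<and> T (snd z) = t}" for s t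
  have ev: "{z. T (fst z) = s \<and> T (snd z) = t} \<in> events" for s t
  proof -
    have "{z. T (fst z) = s \<and> T (snd z) = t} = fst -` {x. T x = s} \<inter> snd -` {x. T x = t}" by auto
    also have "\<dots> \<in> events"
      using measurable_sets[of fst \<gamma> borel, OF _ sets_cell[of s]]
        measurable_sets[of snd \<gamma> borel, OF _ sets_cell[of t]] by (auto simp: sp)
    finally show ?thesis .
  qed
  have 1: "(\<Sum>t\<in>S. w s t) = cell_mass T \<alpha> s" for s
  proof -
    \<comment> \<open>Since \<open>T\<close> maps into \<open>S\<close>, the preimage of a cell is
      the disjoint union of pieces indexed by the cell of the other coordinate.\<close>
    have "cell_mass T \<alpha> s = prob (\<Union>t\<in>S. {z. T (fst z) = s \<and> T (snd z) = t})"
      unfolding marg(1)[symmetric] cell_mass_def using sets_cell[of s] range_T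
      by (subst measure_distr) (auto simp: sp intro!: arg_cong[where f = prob])
    also have "\<dots> = (\<Sum>t\<in>S. w s t)"
      unfolding w_def using finite_S ev
      by (intro finite_measure_finite_Union) (auto simp: disjoint_family_on_def)
    finally show ?thesis by simp
  qed
  have 2: "(\<Sum>s\<in>S. w s t) = cell_mass T \<beta> t" for t
  proof -
    have "cell_mass T \<beta> t = prob (\<Union>s\<in>S. {z. T (fst z) = s \<and> T (snd z) = t})"
      unfolding marg(2)[symmetric] cell_mass_def using sets_cell[of t] range_T
      by (subst measure_distr) (auto simp: sp intro!: arg_cong[where f = prob])
    also have "\<dots> = (\<Sum>s\<in>S. w s t)"
      unfolding w_def using finite_S ev
      by (intro finite_measure_finite_Union) (auto simp: disjoint_family_on_def)
    finally show ?thesis by simp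
  qed
  have w: "w \<in> transport_plans S (cell_mass T \<alpha>) (cell_mass T \<beta>)"
    using 1 2 by (simp add: transport_plans_def w_def)
  have "(\<integral>\<^sup>+ z. ennreal (linf_dist (T (fst z)) (T (snd z)) powr p) \<partial>\<gamma>)
      = (\<integral>\<^sup>+ z. (\<lambda>(s, t). ennreal (linf_dist s t powr p)) (T (fst z), T (snd z)) \<partial>\<gamma>)"
    by simp
  also have "\<dots> = (\<Sum>q\<in>S \<times> S. (\<lambda>(s, t). ennreal (linf_dist s t powr p)) q
      * emeasure \<gamma> {z \<in> space \<gamma>. (T (fst z), T (snd z)) = q})"
  \<comment> \<open>The integrand depends on the quantized pair only, which has finitely many
    values.\<close>
  proof (rule nn_integral_finite_range)
    show "{z \<in> space \<gamma>. (T (fst z), T (snd z)) = q} \<in> events" for q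
      using ev[of "fst q" "snd q"] by (cases q) (simp add: sp)
  qed (use finite_S range_T in auto)
  also have "\<dots> = (\<Sum>q\<in>S \<times> S. ennreal (w (fst q) (snd q) * linf_dist (fst q) (snd q) powr p))"
  proof (intro sum.cong refl)
    fix q :: "plane \<times> plane"
    have "emeasure \<gamma> {z \<in> space \<gamma>. (T (fst z), T (snd z)) = q} = ennreal (w (fst q) (snd q))"
      by (cases q) (simp add: sp w_def emeasure_eq_measure)
    moreover have "0 \<le> w (fst q) (snd q)" by (simp add: w_def)
    ultimately show "(\<lambda>(s, t). ennreal (linf_dist s t powr p)) q
        * emeasure \<gamma> {z \<in> space \<gamma>. (T (fst z), T (snd z)) = q}
      = ennreal (w (fst q) (snd q) * linf_dist (fst q) (snd q) powr p)"
      by (simp add: case_prod_unfold ennreal_mult mult.commute)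
  qed
  also have "\<dots> = ennreal (\<Sum>q\<in>S \<times> S. w (fst q) (snd q) * linf_dist (fst q) (snd q) powr p)"
    by (rule sum_ennreal) (simp add: w_def)
  also have "(\<Sum>q\<in>S \<times> S. w (fst q) (snd q) * linf_dist (fst q) (snd q) powr p) = transport_cost p S w"
    by (simp add: transport_cost_def sum.cartesian_product case_prod_unfold)
  finally have "ennreal (transport_cost p S w)
      = (\<integral>\<^sup>+ z. ennreal (linf_dist (T (fst z)) (T (snd z)) powr p) \<partial>\<gamma>)"
    by (rule sym)
  also have "\<dots> \<le> (\<integral>\<^sup>+ z. ennreal ((linf_dist (fst z) (snd z) +
      (linf_dist (fst z) (T (fst z)) + linf_dist (snd z) (T (snd z)))) powr p) \<partial>\<gamma>)"
  proof (intro nn_integral_mono ennreal_leI powr_mono2)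
    fix z :: "plane \<times> plane"
    show "linf_dist (T (fst z)) (T (snd z)) \<le> linf_dist (fst z) (snd z) +
        (linf_dist (fst z) (T (fst z)) + linf_dist (snd z) (T (snd z)))"
      using linf_dist_triangle[of "T (fst z)" "T (snd z)" "fst z"]
        linf_dist_triangle[of "fst z" "T (snd z)" "snd z"]
        linf_dist_commute[of "T (fst z)" "fst z"] by linarith
  qed (use p in auto)
  also have "\<dots> \<le> ennreal ((U + (\<eta> + \<eta>)) powr p)"
    using \<eta> by (intro nn_integral_powr_add_le[OF p U] nn_integral_coupling_error[OF p \<eta> \<gamma> err] cost)
      (auto intro!: add_nonneg_nonneg)
  finally have "transport_cost p S w \<le> (U + 2 * \<eta>) powr p" by simp
  with w show ?thesis by blast
qed

text \<open>A plan between the cell masses is realized by spreading each of its atoms as a multiple of the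
  product measure on the corresponding product of cells.\<close>

lemma transport_plan_to_coupling:
  assumes p: "1 \<le> p" and \<eta>: "0 < \<eta>" and U: "0 < U"
    and \<alpha>: "prob_space \<alpha>" "sets \<alpha> = sets borel" and \<beta>: "prob_space \<beta>" "sets \<beta> = sets borel"
    and err: "quantization_error p T \<alpha> \<le> ennreal (\<eta> powr p)"
      "quantization_error p T \<beta> \<le> ennreal (\<eta> powr p)"
    and w: "w \<in> transport_plans S (cell_mass T \<alpha>) (cell_mass T \<beta>)"
    and cost: "transport_cost p S w \<le> U powr p"
  shows "\<exists>\<gamma>\<in>couplings \<alpha> \<beta>. (\<integral>\<^sup>+ z. ennreal (linf_dist (fst z) (snd z) powr p) \<partial>\<gamma>)
    \<le> ennreal ((U + 2 * \<eta>) powr p)"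
proof -
  interpret A: prob_space \<alpha> by fact
  interpret B: prob_space \<beta> by fact
  interpret AB: pair_prob_space \<alpha> \<beta> ..
  note [measurable] = measurable_T
  note [measurable_cong] = \<alpha>(2) \<beta>(2)
  let ?a = "cell_mass T \<alpha>" and ?b = "cell_mass T \<beta>"
  \<comment> \<open>The constant density, relative to the product measure, that gives the product of
    the cells of \<open>s\<close> and \<open>t\<close> the mass \<open>w s t\<close>. If one of the
    cells is null, division makes the density 0, and \<open>wa\<close> and \<open>wb\<close> show
    that \<open>w s t\<close> is 0 as well.\<close>
  define h where "h s t = w s t / (?a s * ?b t)" for s t
  have a0: "0 \<le> ?a s" "0 \<le> ?b s" for s by (auto simp: cell_mass_def)
  note w0 = transport_plansD(1)[OF w]
  have h0: "0 \<le> h s t" if "s \<in> S" "t \<in> S" for s t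
    using w0[OF that] a0 by (simp add: h_def)
  have wa: "w s t = 0" if "s \<in> S" "t \<in> S" "?a s = 0" for s t
    using transport_plansD(2)[OF w that(1)] that w0 sum_nonneg_eq_0_iff[OF finite_S, of "w s"] by auto
  have wb: "w s t = 0" if "s \<in> S" "t \<in> S" "?b t = 0" for s t
    using transport_plansD(3)[OF w that(2)] that w0
      sum_nonneg_eq_0_iff[OF finite_S, of "\<lambda>s. w s t"] by auto
  have hb: "h s t * ?b t = w s t / ?a s" if "s \<in> S" "t \<in> S" for s t
    using wb[OF that] by (auto simp: h_def)
  have ha: "h s t * ?a s = w s t / ?b t" if "s \<in> S" "t \<in> S" for s t
    using wa[OF that] by (auto simp: h_def)
  have sumb: "(\<Sum>t\<in>S. ennreal (h s t) * ennreal (?b t)) = 1" if "s \<in> S" "0 < ?a s" for s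
  proof -
    have "(\<Sum>t\<in>S. ennreal (h s t) * ennreal (?b t)) = ennreal (\<Sum>t\<in>S. w s t / ?a s)"
      using that h0 hb a0 w0 by (simp flip: ennreal_mult sum_ennreal)
    also have "(\<Sum>t\<in>S. w s t / ?a s) = 1"
      using transport_plansD(2)[OF w that(1)] that(2) by (simp flip: sum_divide_distrib)
    finally show ?thesis by simp
  qed
  have suma: "(\<Sum>s\<in>S. ennreal (h s t) * ennreal (?a s)) = 1" if "t \<in> S" "0 < ?b t" for t
  proof -
    have "(\<Sum>s\<in>S. ennreal (h s t) * ennreal (?a s)) = ennreal (\<Sum>s\<in>S. w s t / ?b t)"
      using that h0 ha a0 w0 by (simp flip: ennreal_mult sum_ennreal)
    also have "(\<Sum>s\<in>S. w s t / ?b t) = 1"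
      using transport_plansD(3)[OF w that(1)] that(2) by (simp flip: sum_divide_distrib)
    finally show ?thesis by simp
  qed
  define k where "k z = ennreal (h (T (fst z)) (T (snd z)))" for z :: "plane \<times> plane"
  have k: "k \<in> borel_measurable (\<alpha> \<Otimes>\<^sub>M \<beta>)"
    unfolding k_def by (rule borel_measurable_comp_T2) measurable
  note [measurable] = k
  define \<gamma> where "\<gamma> = density (\<alpha> \<Otimes>\<^sub>M \<beta>) k"
  have setsAB: "sets (\<alpha> \<Otimes>\<^sub>M \<beta>) = sets (borel :: (plane \<times> plane) measure)"
    by (rule trans[OF sets_pair_measure_cong[OF \<alpha>(2) \<beta>(2)] arg_cong[OF borel_prod, of sets]])
  then have sets: "sets \<gamma> = sets borel" by (simp add: \<gamma>_def)
  have int: "(\<integral>\<^sup>+ z. g z \<partial>\<gamma>) = (\<integral>\<^sup>+ z. k z * g z \<partial>(\<alpha> \<Otimes>\<^sub>M \<beta>))"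
    if "g \<in> borel_measurable (\<alpha> \<Otimes>\<^sub>M \<beta>)" for g
    unfolding \<gamma>_def using that by (simp add: nn_integral_density)
  have marg1: "(\<integral>\<^sup>+ z. indicator E (fst z) \<partial>\<gamma>) = emeasure \<alpha> E" if E: "E \<in> sets borel" for E
  proof -
    have [measurable]: "E \<in> sets \<alpha>" using E \<alpha> by simp
    have "(\<integral>\<^sup>+ z. indicator E (fst z) \<partial>\<gamma>) = (\<integral>\<^sup>+ z. k z * indicator E (fst z) \<partial>(\<alpha> \<Otimes>\<^sub>M \<beta>))"
      by (intro int) measurable
    also have "\<dots> = (\<integral>\<^sup>+ x. \<integral>\<^sup>+ y. k (x, y) * indicator E x \<partial>\<beta> \<partial>\<alpha>)"
      by (subst B.nn_integral_fst[symmetric]) auto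
    also have "\<dots> = (\<integral>\<^sup>+ x. indicator E x \<partial>\<alpha>)"
    \<comment> \<open>Almost every \<open>x\<close> lies in a cell of positive mass, and for such an
      \<open>x\<close> the density integrates over \<open>y\<close> to 1 by
      \<open>sumb\<close>.\<close>
    proof (intro nn_integral_cong_AE, use AE_cell_mass_pos[OF \<alpha>] in eventually_elim)
      fix x assume "0 < ?a (T x)"
      then show "(\<integral>\<^sup>+ y. k (x, y) * indicator E x \<partial>\<beta>) = indicator E x"
        using nn_integral_T[OF \<beta>, of "\<lambda>t. ennreal (h (T x) t)"] sumb[OF range_T]
        by (cases "x \<in> E") (simp_all add: k_def)
    qed
    finally show ?thesis by simp
  qed
  have marg2: "(\<integral>\<^sup>+ z. indicator E (snd z) \<partial>\<gamma>) = emeasure \<beta> E" if E: "E \<in> sets borel" for E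
  proof -
    have [measurable]: "E \<in> sets \<beta>" using E \<beta> by simp
    have "(\<integral>\<^sup>+ z. indicator E (snd z) \<partial>\<gamma>) = (\<integral>\<^sup>+ z. k z * indicator E (snd z) \<partial>(\<alpha> \<Otimes>\<^sub>M \<beta>))"
      by (intro int) measurable
    also have "\<dots> = (\<integral>\<^sup>+ y. \<integral>\<^sup>+ x. k (x, y) * indicator E y \<partial>\<alpha> \<partial>\<beta>)"
      by (subst AB.nn_integral_snd[symmetric]) auto
    also have "\<dots> = (\<integral>\<^sup>+ y. indicator E y \<partial>\<beta>)"
    proof (intro nn_integral_cong_AE, use AE_cell_mass_pos[OF \<beta>] in eventually_elim)
      fix y assume "0 < ?b (T y)"
      then show "(\<integral>\<^sup>+ x. k (x, y) * indicator E y \<partial>\<alpha>) = indicator E y"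
        using nn_integral_T[OF \<alpha>, of "\<lambda>s. ennreal (h s (T y))"] suma[OF range_T]
        by (cases "y \<in> E") (simp_all add: k_def)
    qed
    finally show ?thesis by simp
  qed
  have fst_snd: "fst \<in> \<gamma> \<rightarrow>\<^sub>M borel" "snd \<in> \<gamma> \<rightarrow>\<^sub>M borel"
    unfolding \<gamma>_def by measurable
  have coupling: "\<gamma> \<in> couplings \<alpha> \<beta>"
    unfolding couplings_def
  proof (intro CollectI conjI)
    show "prob_space \<gamma>"
      using marg1[of UNIV] A.emeasure_space_1 sets_eq_imp_space_eq[OF \<alpha>(2)]
      by (intro prob_spaceI) (simp add: nn_integral_const)
    show "sets \<gamma> = sets borel" by (rule sets)
    show "distr \<gamma> borel fst = \<alpha>"
    proof (rule measure_eqI)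
      fix E assume "E \<in> sets (distr \<gamma> borel fst)"
      then have E: "E \<in> sets borel" by simp
      have "emeasure (distr \<gamma> borel fst) E = (\<integral>\<^sup>+ x. indicator E x \<partial>distr \<gamma> borel fst)"
        using E by simp
      also have "\<dots> = (\<integral>\<^sup>+ z. indicator E (fst z) \<partial>\<gamma>)"
        using E by (intro nn_integral_distr fst_snd) auto
      finally show "emeasure (distr \<gamma> borel fst) E = emeasure \<alpha> E" using marg1[OF E] by simp
    qed (simp add: \<alpha>)
    show "distr \<gamma> borel snd = \<beta>"
    proof (rule measure_eqI)
      fix E assume "E \<in> sets (distr \<gamma> borel snd)"
      then have E: "E \<in> sets borel" by simp
      have "emeasure (distr \<gamma> borel snd) E = (\<integral>\<^sup>+ x. indicator E x \<partial>distr \<gamma> borel snd)"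
        using E by simp
      also have "\<dots> = (\<integral>\<^sup>+ z. indicator E (snd z) \<partial>\<gamma>)"
        using E by (intro nn_integral_distr fst_snd) auto
      finally show "emeasure (distr \<gamma> borel snd) E = emeasure \<beta> E" using marg2[OF E] by simp
    qed (simp add: \<beta>)
  qed
  have "(\<integral>\<^sup>+ z. ennreal (linf_dist (T (fst z)) (T (snd z)) powr p) \<partial>\<gamma>)
      = (\<integral>\<^sup>+ z. k z * ennreal (linf_dist (T (fst z)) (T (snd z)) powr p) \<partial>(\<alpha> \<Otimes>\<^sub>M \<beta>))"
    by (intro int) measurable
  also have "\<dots> = (\<integral>\<^sup>+ x. \<integral>\<^sup>+ y. k (x, y) * ennreal (linf_dist (T x) (T y) powr p) \<partial>\<beta> \<partial>\<alpha>)"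
    by (subst B.nn_integral_fst[symmetric]) auto
  also have "\<dots> = (\<integral>\<^sup>+ x. (\<Sum>t\<in>S. ennreal (h (T x) t) * ennreal (linf_dist (T x) t powr p)
      * ennreal (?b t)) \<partial>\<alpha>)"
    \<comment> \<open>Integrating out \<open>y\<close> and then \<open>x\<close> leaves finite sums
      over cells, in which the cell masses cancel against the denominators of
      \<open>h\<close>.\<close>
    unfolding k_def fst_conv snd_conv
    by (intro nn_integral_cong nn_integral_T[OF \<beta>])
  also have "\<dots> = (\<Sum>s\<in>S. (\<Sum>t\<in>S. ennreal (h s t) * ennreal (linf_dist s t powr p)
      * ennreal (?b t)) * ennreal (?a s))"
    by (rule nn_integral_T[OF \<alpha>])
  also have "\<dots> = (\<Sum>s\<in>S. \<Sum>t\<in>S. ennreal (w s t * linf_dist s t powr p))"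
    unfolding sum_distrib_right
  proof (intro sum.cong refl)
    fix s t assume st: "s \<in> S" "t \<in> S"
    have "h s t * linf_dist s t powr p * ?b t * ?a s = (h s t * ?b t) * ?a s * linf_dist s t powr p"
      by simp
    also have "\<dots> = w s t * linf_dist s t powr p"
      using wa[OF st] unfolding hb[OF st] by auto
    finally have eq: "h s t * linf_dist s t powr p * ?b t * ?a s = w s t * linf_dist s t powr p" .
    show "ennreal (h s t) * ennreal (linf_dist s t powr p) * ennreal (?b t) * ennreal (?a s)
        = ennreal (w s t * linf_dist s t powr p)"
      unfolding eq[symmetric] using h0[OF st] a0 by (simp add: ennreal_mult)
  qed
  also have "\<dots> = ennreal (transport_cost p S w)"
    using w0 by (simp add: transport_cost_def sum_nonneg flip: sum_ennreal)
  also have "\<dots> \<le> ennreal (U powr p)" by (rule ennreal_leI[OF cost])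
  finally have disc: "(\<integral>\<^sup>+ z. ennreal (linf_dist (T (fst z)) (T (snd z)) powr p) \<partial>\<gamma>)
    \<le> ennreal (U powr p)" .
  note [measurable] = fst_snd
  have "(\<integral>\<^sup>+ z. ennreal (linf_dist (fst z) (snd z) powr p) \<partial>\<gamma>)
    \<le> (\<integral>\<^sup>+ z. ennreal ((linf_dist (T (fst z)) (T (snd z)) +
      (linf_dist (fst z) (T (fst z)) + linf_dist (snd z) (T (snd z)))) powr p) \<partial>\<gamma>)"
  \<comment> \<open>The triangle inequality now goes the other way: the original distance is at most
    the quantized one plus the two displacements.\<close>
  proof (intro nn_integral_mono ennreal_leI powr_mono2)
    fix z :: "plane \<times> plane"
    show "linf_dist (fst z) (snd z) \<le> linf_dist (T (fst z)) (T (snd z)) +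
        (linf_dist (fst z) (T (fst z)) + linf_dist (snd z) (T (snd z)))"
      using linf_dist_triangle[of "fst z" "snd z" "T (fst z)"]
        linf_dist_triangle[of "T (fst z)" "snd z" "T (snd z)"]
        linf_dist_commute[of "T (snd z)" "snd z"] by linarith
  qed (use p in auto)
  also have "\<dots> \<le> ennreal ((U + (\<eta> + \<eta>)) powr p)"
    using \<eta> by (intro nn_integral_powr_add_le[OF p U] nn_integral_coupling_error[OF p \<eta> coupling err] disc)
      (auto intro!: add_nonneg_nonneg)
  finally show ?thesis using coupling by auto
qed

end

section \<open>Existence of fine quantizers\<close>

text \<open>The identity is a pointwise limit of simple functions of at most twice the norm. A
  multiple of \<open>linf_dist x 0 powr p\<close>, integrable by the moment condition, dominates
  their errors, which therefore tend to 0. As \<open>A\<close> is finite, one index serves all its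
  measures.\<close>

lemma ex_quantizer:
  assumes p: "1 \<le> p" and A: "finite A" "A \<subseteq> wasserstein_space p" and \<eta>: "0 < \<eta>"
  shows "\<exists>S T. quantizer S T \<and> (\<forall>\<alpha>\<in>A. quantization_error p T \<alpha> \<le> ennreal (\<eta> powr p))"
proof -
  obtain F :: "nat \<Rightarrow> plane \<Rightarrow> plane"
    where F: "\<And>i. simple_function borel (F i)" "\<And>x. (\<lambda>i. F i x) \<longlonglongrightarrow> x"
      "\<And>i x. dist (F i x) 0 \<le> 2 * dist x 0"
    using borel_measurable_implies_sequence_metric[of "\<lambda>x. x" "borel :: plane measure" 0] by auto
  \<comment> \<open>The factor 3 comes from \<open>norm x + norm (F i x) \<le> 3 * norm x\<close>,
    the root from comparing the Euclidean norm with \<open>infnorm\<close>.\<close>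
  define c where "c = 3 * sqrt (DIM(plane))"
  have c: "0 \<le> c" by (simp add: c_def)
  have F_bound: "linf_dist x (F i x) \<le> c * linf_dist x 0" for i x
  proof -
    have "linf_dist x (F i x) \<le> norm (x - F i x)"
      unfolding linf_dist_def by (rule infnorm_le_norm)
    also have "\<dots> \<le> 3 * norm x"
      using norm_triangle_ineq4[of x "F i x"] F(3)[of i x] by simp
    also have "\<dots> \<le> c * linf_dist x 0"
      using norm_le_infnorm[of x] by (simp add: c_def linf_dist_def)
    finally show ?thesis .
  qed
  have F_lim: "(\<lambda>i. linf_dist x (F i x)) \<longlonglongrightarrow> 0" for x
  proof (rule tendsto_sandwich[OF _ _ tendsto_const])
    show "(\<lambda>i. dist (F i x) x) \<longlonglongrightarrow> 0" using F(2)[of x] by (rule tendsto_dist_iff[THEN iffD1])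
    show "\<forall>\<^sub>F i in sequentially. linf_dist x (F i x) \<le> dist (F i x) x"
      unfolding linf_dist_def using infnorm_le_norm
      by (intro always_eventually allI) (simp add: dist_norm norm_minus_commute)
  qed simp
  have "\<forall>\<^sub>F i in sequentially. \<forall>\<alpha>\<in>A. quantization_error p (F i) \<alpha> < ennreal (\<eta> powr p)"
  proof (intro eventually_ball_finite A(1) ballI)
    fix \<alpha> assume "\<alpha> \<in> A"
    then have [measurable_cong]: "sets \<alpha> = sets borel"
      and moment: "(\<integral>\<^sup>+ x. ennreal (linf_dist x 0 powr p) \<partial>\<alpha>) < \<infinity>"
      using A(2) by (auto simp: wasserstein_space_def)
    have [measurable]: "F i \<in> borel_measurable borel" for i
      using F(1) by (rule borel_measurable_simple_function)
    have "(\<lambda>i. \<integral>\<^sup>+ x. ennreal (linf_dist x (F i x) powr p) \<partial>\<alpha>) \<longlonglongrightarrow> (\<integral>\<^sup>+ x. 0 \<partial>\<alpha>)"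
    proof (rule nn_integral_dominated_convergence)
      show "(\<integral>\<^sup>+ x. ennreal (c powr p) * ennreal (linf_dist x 0 powr p) \<partial>\<alpha>) < \<infinity>"
        using moment by (simp add: nn_integral_cmult ennreal_mult_less_top)
      show "AE x in \<alpha>. ennreal (linf_dist x (F i x) powr p)
          \<le> ennreal (c powr p) * ennreal (linf_dist x 0 powr p)" for i
      proof (rule AE_I2)
        fix x
        have "linf_dist x (F i x) powr p \<le> (c * linf_dist x 0) powr p"
          using p by (intro powr_mono2 F_bound) auto
        then show "ennreal (linf_dist x (F i x) powr p)
            \<le> ennreal (c powr p) * ennreal (linf_dist x 0 powr p)"
          using c by (simp add: powr_mult flip: ennreal_mult)
      qed
      show "AE x in \<alpha>. (\<lambda>i. ennreal (linf_dist x (F i x) powr p)) \<longlonglongrightarrow> 0"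
      proof (rule AE_I2)
        fix x
        have "(\<lambda>i. linf_dist x (F i x) powr p) \<longlonglongrightarrow> 0"
          using p by (intro tendsto_zero_powrI[OF F_lim tendsto_const]) auto
        then show "(\<lambda>i. ennreal (linf_dist x (F i x) powr p)) \<longlonglongrightarrow> 0"
          using tendsto_ennrealI by fastforce
      qed
    qed measurable
    then show "\<forall>\<^sub>F i in sequentially. quantization_error p (F i) \<alpha> < ennreal (\<eta> powr p)"
      using \<eta> unfolding quantization_error_def by (intro order_tendstoD(2)) auto
  qed
  then obtain i where i: "\<forall>\<alpha>\<in>A. quantization_error p (F i) \<alpha> < ennreal (\<eta> powr p)"
    by (auto dest!: eventually_happens)
  have "quantizer (range (F i)) (F i)"
    using F(1)[of i] by unfold_locales
      (auto simp: simple_function_def intro: borel_measurable_simple_function)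
  with i show ?thesis by (blast intro: less_imp_le)
qed

section \<open>Nearly optimal couplings\<close>

lemma wasserstein_measure_le:
  assumes "1 \<le> p" "0 \<le> V" "\<gamma> \<in> couplings \<alpha> \<beta>"
    and "(\<integral>\<^sup>+ z. ennreal (linf_dist (fst z) (snd z) powr p) \<partial>\<gamma>) \<le> ennreal (V powr p)"
  shows "wasserstein_measure p \<alpha> \<beta> \<le> V"
proof -
  let ?I = "INF \<gamma>\<in>couplings \<alpha> \<beta>. \<integral>\<^sup>+ z. ennreal (linf_dist (fst z) (snd z) powr p) \<partial>\<gamma>"
  have "?I \<le> ennreal (V powr p)" by (intro INF_lower2[OF assms(3)] assms(4))
  then have "enn2real ?I \<le> V powr p" by (intro enn2real_leI) auto
  then have "wasserstein_measure p \<alpha> \<beta> \<le> (V powr p) powr (1 / p)"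
    unfolding wasserstein_measure_def using assms(1) by (intro powr_mono2) auto
  then show ?thesis using assms by (simp add: powr_powr)
qed

text \<open>A coupling of finite cost makes the infimum finite, so \<open>enn2real\<close> preserves
  its value. Enlarging the distance by \<delta> gives a strictly larger bound, which some coupling
  undercuts.\<close>

lemma wasserstein_measure_approx:
  assumes p: "1 \<le> p" and \<delta>: "0 < \<delta>" and \<gamma>: "\<gamma> \<in> couplings \<alpha> \<beta>"
    and fin: "(\<integral>\<^sup>+ z. ennreal (linf_dist (fst z) (snd z) powr p) \<partial>\<gamma>) < \<infinity>"
  shows "\<exists>\<gamma>'\<in>couplings \<alpha> \<beta>. (\<integral>\<^sup>+ z. ennreal (linf_dist (fst z) (snd z) powr p) \<partial>\<gamma>')
    \<le> ennreal ((wasserstein_measure p \<alpha> \<beta> + \<delta>) powr p)"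
proof -
  let ?I = "INF \<gamma>\<in>couplings \<alpha> \<beta>. \<integral>\<^sup>+ z. ennreal (linf_dist (fst z) (snd z) powr p) \<partial>\<gamma>"
  let ?W = "wasserstein_measure p \<alpha> \<beta>"
  have W0: "0 \<le> ?W" by (simp add: wasserstein_measure_def)
  have "?I \<le> (\<integral>\<^sup>+ z. ennreal (linf_dist (fst z) (snd z) powr p) \<partial>\<gamma>)"
    by (rule INF_lower[OF \<gamma>])
  then have "?I < \<infinity>" using fin by (rule le_less_trans)
  then have "?I = ennreal (enn2real ?I)" by simp
  also have "enn2real ?I = ?W powr p"
    using p by (simp add: wasserstein_measure_def powr_powr)
  also have "ennreal (?W powr p) < ennreal ((?W + \<delta>) powr p)"
    using p \<delta> W0 by (intro ennreal_lessI powr_less_mono2) auto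
  finally show ?thesis unfolding INF_less_iff by (blast intro: less_imp_le)
qed

context quantizer
begin

text \<open>The product plan between the cell masses has a real-valued cost, and lifting it to a
  coupling keeps the cost finite.\<close>

lemma ex_finite_cost_coupling:
  assumes p: "1 \<le> p" and \<eta>: "0 < \<eta>"
    and \<alpha>: "prob_space \<alpha>" "sets \<alpha> = sets borel" and \<beta>: "prob_space \<beta>" "sets \<beta> = sets borel"
    and err: "quantization_error p T \<alpha> \<le> ennreal (\<eta> powr p)"
      "quantization_error p T \<beta> \<le> ennreal (\<eta> powr p)"
  shows "\<exists>\<gamma>\<in>couplings \<alpha> \<beta>. (\<integral>\<^sup>+ z. ennreal (linf_dist (fst z) (snd z) powr p) \<partial>\<gamma>) < \<infinity>"
proof -
  define w where "w s t = cell_mass T \<alpha> s * cell_mass T \<beta> t" for s t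
  have w: "w \<in> transport_plans S (cell_mass T \<alpha>) (cell_mass T \<beta>)"
    using sum_cell_mass[OF \<alpha>] sum_cell_mass[OF \<beta>]
    by (simp add: transport_plans_def w_def cell_mass_def flip: sum_distrib_left sum_distrib_right)
  \<comment> \<open>Adding 1 keeps \<open>U\<close> positive even if the plan costs nothing.\<close>
  define U where "U = transport_cost p S w powr (1 / p) + 1"
  have "transport_cost p S w = (transport_cost p S w powr (1 / p)) powr p"
    using transport_cost_nonneg[OF w] p by (simp add: powr_powr)
  also have "\<dots> \<le> U powr p"
    using p by (intro powr_mono2) (auto simp: U_def)
  finally have "transport_cost p S w \<le> U powr p" .
  moreover have "0 < U" by (simp add: U_def add_nonneg_pos)
  ultimately show ?thesis
    using transport_plan_to_coupling[OF p \<eta> _ \<alpha> \<beta> err w] by (fastforce intro: le_less_trans)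
qed

end

section \<open>Distance to the diagonal, relabelled plans and bounds for diagrams\<close>

lemma dist_diagonal_eq: "dist_diagonal x = \<bar>snd x - fst x\<bar> / 2"
proof -
  \<comment> \<open>The infimum is attained at the midpoint of the two coordinates. It is a lower
    bound because a maximum is at least the mean of its two arguments.\<close>
  define m where "m = (fst x + snd x) / 2"
  have "linf_dist x (m, m) = \<bar>snd x - fst x\<bar> / 2"
    unfolding linf_dist_eq_max m_def by (simp add: max_def field_simps) linarith
  moreover have "\<bar>snd x - fst x\<bar> / 2 \<le> linf_dist x y" if "y \<in> diagonal" for y
  proof -
    obtain v where "y = (v, v)" using \<open>y \<in> diagonal\<close> by (auto simp: diagonal_def)
    moreover have "\<bar>snd x - fst x\<bar> \<le> \<bar>fst x - v\<bar> + \<bar>snd x - v\<bar>" by arith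
    ultimately show ?thesis unfolding linf_dist_eq_max by (simp add: max_def)
  qed
  moreover have "(m, m) \<in> diagonal" by (simp add: diagonal_def)
  ultimately show ?thesis
    unfolding dist_diagonal_def by (intro cInf_eq_minimum) (force simp: image_iff)+
qed

lemma transport_plans_image:
  assumes "inj_on \<phi> S"
  shows "w \<in> transport_plans (\<phi> ` S) a b
    \<longleftrightarrow> (\<lambda>s t. w (\<phi> s) (\<phi> t)) \<in> transport_plans S (\<lambda>s. a (\<phi> s)) (\<lambda>t. b (\<phi> t))"
  using assms by (simp add: transport_plans_def sum.reindex)

text \<open>The factor \<open>c\<close> compensates the scaling by \<phi>; it is used with the
  number \<open>N\<close> that governs the multiplicities.\<close>

lemma transport_cost_image:
  assumes "inj_on \<phi> S"
    and "\<And>s t. s \<in> S \<Longrightarrow> t \<in> S \<Longrightarrow> c * linf_dist (\<phi> s) (\<phi> t) powr p = linf_dist s t powr p"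
  shows "c * transport_cost p (\<phi> ` S) w = transport_cost p S (\<lambda>s t. w (\<phi> s) (\<phi> t))"
proof -
  have "c * transport_cost p (\<phi> ` S) w
      = (\<Sum>s\<in>S. \<Sum>t\<in>S. w (\<phi> s) (\<phi> t) * (c * linf_dist (\<phi> s) (\<phi> t) powr p))"
    using assms(1) by (simp add: transport_cost_def sum.reindex sum_distrib_left mult.left_commute)
  also have "\<dots> = (\<Sum>s\<in>S. \<Sum>t\<in>S. w (\<phi> s) (\<phi> t) * linf_dist s t powr p)"
    by (intro sum.cong refl) (simp add: assms(2))
  finally show ?thesis by (simp add: transport_cost_def)
qed

lemma matching_cost_nonneg: "0 \<le> matching_cost p D1 D2 m"
  by (simp add: matching_cost_def split: prod.split)

lemma wasserstein_diagram_le: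
  assumes "m \<in> partial_matchings D1 D2"
  shows "wasserstein_diagram p D1 D2 \<le> matching_cost p D1 D2 m"
  unfolding wasserstein_diagram_def
  using assms by (intro cINF_lower bdd_belowI2[where m = 0] matching_cost_nonneg)

lemma wasserstein_diagram_ge:
  assumes "\<And>m. m \<in> partial_matchings D1 D2 \<Longrightarrow> c \<le> matching_cost p D1 D2 m"
  shows "c \<le> wasserstein_diagram p D1 D2"
proof -
  \<comment> \<open>The empty matching shows that the infimum is taken over a nonempty set.\<close>
  have "({#}, {#}, {#}) \<in> partial_matchings D1 D2" by (simp add: partial_matchings_def)
  then show ?thesis
    unfolding wasserstein_diagram_def using assms by (intro cINF_greatest) auto
qed

section \<open>The scaled and shifted diagrams, and the two estimates\<close>

theorem proposition18:
  fixes p \<epsilon> :: real and A :: "plane measure set"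
  assumes "1 \<le> p"
    and "finite A"
    and "A \<subseteq> wasserstein_space p"
    and "\<epsilon> > 0"
  shows "\<exists>f :: plane measure \<Rightarrow> plane multiset.
    f ` A \<subseteq> diagrams \<and>
    (\<forall>\<alpha>\<in>A. \<forall>\<beta>\<in>A.
       wasserstein_measure p \<alpha> \<beta> - \<epsilon> \<le> wasserstein_diagram p (f \<alpha>) (f \<beta>) \<and>
       wasserstein_diagram p (f \<alpha>) (f \<beta>) \<le> wasserstein_measure p \<alpha> \<beta> + \<epsilon>)"
proof -
  note p = assms(1)
  \<comment> \<open>The lower estimate will lose \<open>\<delta> + 2 * \<eta>\<close>, the upper one
    \<open>2 * \<delta> + 2 * \<eta>\<close>, which is three quarters of \<epsilon>.\<close>
  define \<delta> where "\<delta> = \<epsilon> / 4"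
  define \<eta> where "\<eta> = \<delta> / 2"
  have \<delta>: "0 < \<delta>" and \<eta>: "0 < \<eta>" using assms(4) by (simp_all add: \<delta>_def \<eta>_def)
  obtain S T where "quantizer S T"
    and err: "\<And>\<alpha>. \<alpha> \<in> A \<Longrightarrow> quantization_error p T \<alpha> \<le> ennreal (\<eta> powr p)"
    using ex_quantizer[OF assms(1-3) \<eta>] by blast
  then interpret quantizer S T by simp
  note S = finite_S
  have prob: "prob_space \<alpha>" "sets \<alpha> = sets borel" if "\<alpha> \<in> A" for \<alpha>
    using assms(3) that by (auto simp: wasserstein_space_def)
  obtain M where M: "0 < M" "\<And>s. s \<in> S \<Longrightarrow> linf_dist s 0 \<le> M"
  proof
    show "0 < Max (insert 1 ((\<lambda>s. linf_dist s 0) ` S))"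
      using S by (simp add: Max_gr_iff)
    show "linf_dist s 0 \<le> Max (insert 1 ((\<lambda>s. linf_dist s 0) ` S))" if "s \<in> S" for s
      using S that by (intro Max_ge) auto
  qed
  have dist_le: "linf_dist s t \<le> 2 * M" if "s \<in> S" "t \<in> S" for s t
    using linf_dist_triangle[of s t 0] linf_dist_commute[of 0 t] M(2)[OF that(1)] M(2)[OF that(2)] by linarith
  define K where "K = real (card S)"
  \<comment> \<open>As \<open>N * H = (4 * M) powr p\<close> for the \<open>H\<close> defined below,
    this choice gives \<open>2 * (H * K\<^sup>2) \<le> \<delta> powr p\<close>; the maximum with 1
    keeps \<open>N\<close> positive.\<close>
  obtain N :: nat where N: "max 1 (2 * (4 * M) powr p * K\<^sup>2 / \<delta> powr p) \<le> real N"
    using real_arch_simple by blast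
  have N0: "0 < N" using N by (cases N) auto
  \<comment> \<open>Scaling by N^(-1/p) compensates for points occurring with multiplicity about N times their
    mass. The shift makes deleting a point at least as expensive as any transport within S.\<close>
  define c where "c = real N powr (- 1 / p)"
  have c: "0 < c" "real N * (c * x) powr p = x powr p" if "0 \<le> x" for x
  proof -
    show "0 < c" using N0 by (simp add: c_def)
    have "c powr p = real N powr - 1"
      using p by (simp add: c_def powr_powr)
    also have "\<dots> = 1 / real N"
      using N0 by (simp add: powr_minus_divide)
    finally have "c powr p = 1 / real N" .
    then show "real N * (c * x) powr p = x powr p"
      using N0 that \<open>0 < c\<close> by (simp add: powr_mult)
  qed
  have c0: "0 < c" using c(1)[of 0] by simp
  \<comment> \<open>Coordinates of points of \<open>S\<close> are at most \<open>M\<close> in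
    absolute value, so before scaling the shifted coordinates differ by between \<open>4 * M\<close>
    and \<open>8 * M\<close>. Half of this is the distance to the diagonal, which is thus at least
    \<open>2 * M\<close>, the bound on distances within \<open>S\<close>.\<close>
  define \<phi> where "\<phi> s = c *\<^sub>R (s + (- 3 * M, 3 * M))" for s :: plane
  define \<psi> where "\<psi> y = (1 / c) *\<^sub>R y - (- 3 * M, 3 * M)" for y :: plane
  have \<psi>\<phi>: "\<psi> (\<phi> s) = s" for s using c0 by (simp add: \<phi>_def \<psi>_def)
  have inj: "inj_on \<phi> S" by (rule inj_on_inverseI) (rule \<psi>\<phi>)
  have S': "finite (\<phi> ` S)" using S by simp
  have \<phi>_dist: "linf_dist (\<phi> s) (\<phi> t) = c * linf_dist s t" for s t
    using c0 unfolding \<phi>_def by (simp only: linf_dist_scaleR linf_dist_translate abs_of_pos)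
  have \<phi>_diff: "snd (\<phi> s) - fst (\<phi> s) = c * (snd s - fst s + 6 * M)" for s
    by (simp add: \<phi>_def algebra_simps)
  have diff_bounds: "4 * M \<le> snd s - fst s + 6 * M" "snd s - fst s + 6 * M \<le> 8 * M" if "s \<in> S" for s
    using M(2)[OF that] by (auto simp: linf_dist_eq_max)
  have \<phi>_diag: "c * (2 * M) \<le> dist_diagonal (\<phi> s)" "dist_diagonal (\<phi> s) \<le> c * (4 * M)"
    if "s \<in> S" for s
  proof -
    have "0 \<le> snd s - fst s + 6 * M" using diff_bounds[OF that] M(1) by linarith
    then have eq: "dist_diagonal (\<phi> s) = c * ((snd s - fst s + 6 * M) / 2)"
      unfolding dist_diagonal_eq \<phi>_diff using c0 by (simp add: abs_mult)
    show "c * (2 * M) \<le> dist_diagonal (\<phi> s)" "dist_diagonal (\<phi> s) \<le> c * (4 * M)"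
      unfolding eq using diff_bounds[OF that] c0 by (auto intro!: mult_left_mono)
  qed
  \<comment> \<open>\<open>C\<close> bounds p-th powers of distances within the image of
    \<open>S\<close> from above and those to the diagonal from below; \<open>H\<close> bounds the
    latter from above.\<close>
  define C where "C = (c * (2 * M)) powr p"
  define H where "H = (c * (4 * M)) powr p"
  have CH: "0 \<le> C" "0 \<le> H" by (simp_all add: C_def H_def)
  have card: "real (card (\<phi> ` S)) = K" using inj by (simp add: card_image K_def)
  have "real N * (2 * (H * K\<^sup>2)) = 2 * (4 * M) powr p * K\<^sup>2"
    using c(2)[of "4 * M"] M(1) by (simp add: H_def)
  also have "\<dots> \<le> real N * \<delta> powr p"
    using N \<delta> by (simp add: pos_divide_le_eq)
  finally have HK: "2 * (H * K\<^sup>2) \<le> \<delta> powr p" using N0 by simp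
  have CK: "C * K \<le> \<delta> powr p"
  proof -
    have "C \<le> H" unfolding C_def H_def using c0 M(1) p by (intro powr_mono2) auto
    \<comment> \<open>\<open>K\<close> is a natural number, so the \<open>N\<close> chosen for the
      quadratic error also controls the linear one.\<close>
    moreover have "K \<le> K\<^sup>2" by (cases "card S") (auto simp: K_def power2_eq_square)
    ultimately have "C * K \<le> H * K\<^sup>2" using CH by (intro mult_mono) (auto simp: K_def)
    moreover have "0 \<le> H * K\<^sup>2" using CH by simp
    ultimately show ?thesis using HK by linarith
  qed
  \<comment> \<open>Weights are needed at the scaled points, so cell masses are pulled back along
    the inverse \<psi> of \<phi>.\<close>
  define mass where "mass \<alpha> y = cell_mass T \<alpha> (\<psi> y)" for \<alpha> y
  define f where "f \<alpha> = sample N (\<phi> ` S) (mass \<alpha>)" for \<alpha>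
  have mass_\<phi>: "mass \<alpha> (\<phi> s) = cell_mass T \<alpha> s" for \<alpha> s by (simp add: mass_def \<psi>\<phi>)
  have mass0: "0 \<le> mass \<alpha> y" for \<alpha> y by (simp add: mass_def cell_mass_def)
  have mass1: "sum (mass \<alpha>) (\<phi> ` S) = 1" if "\<alpha> \<in> A" for \<alpha>
    using sum_cell_mass[OF prob[OF that]] inj by (simp add: sum.reindex mass_\<phi>)
  have plans: "w \<in> transport_plans (\<phi> ` S) (mass \<alpha>) (mass \<beta>)
      \<longleftrightarrow> (\<lambda>s t. w (\<phi> s) (\<phi> t)) \<in> transport_plans S (cell_mass T \<alpha>) (cell_mass T \<beta>)" for w \<alpha> \<beta>
    using transport_plans_image[OF inj, of w "mass \<alpha>" "mass \<beta>"] by (simp add: mass_\<phi>)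
  have cost: "real N * transport_cost p (\<phi> ` S) w = transport_cost p S (\<lambda>s t. w (\<phi> s) (\<phi> t))" for w
    by (rule transport_cost_image[OF inj]) (simp add: \<phi>_dist c(2))
  have "f \<alpha> \<in> diagrams" for \<alpha>
  proof -
    have "fst y < snd y" if "y \<in> \<phi> ` S" for y
    proof -
      obtain s where s: "s \<in> S" "y = \<phi> s" using \<open>y \<in> \<phi> ` S\<close> by blast
      have "0 < c * (snd s - fst s + 6 * M)" using diff_bounds(1)[OF s(1)] M(1) c0 by simp
      then show ?thesis using \<phi>_diff[of s] s(2) by simp
    qed
    then show ?thesis
      using set_mset_sample[OF S', of N "mass \<alpha>"] unfolding diagrams_def f_def by blast
  qed
  \<comment> \<open>Any matching is completed to a plan on the scaled points, carried back to
    \<open>S\<close> and lifted to a coupling.\<close>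
  moreover have "wasserstein_measure p \<alpha> \<beta> - \<epsilon> \<le> wasserstein_diagram p (f \<alpha>) (f \<beta>)"
    if A: "\<alpha> \<in> A" "\<beta> \<in> A" for \<alpha> \<beta>
  proof (rule wasserstein_diagram_ge)
    fix m assume m: "m \<in> partial_matchings (f \<alpha>) (f \<beta>)"
    let ?c = "matching_cost p (f \<alpha>) (f \<beta>) m"
    have "\<exists>w\<in>transport_plans (\<phi> ` S) (mass \<alpha>) (mass \<beta>). real N * transport_cost p (\<phi> ` S) w
        \<le> ?c powr p + C * real (card (\<phi> ` S))"
      unfolding f_def
    proof (rule matching_to_transport_plan[OF p S' N0 mass0 mass1[OF A(1)] mass0 mass1[OF A(2)] CH(1)])
      show "linf_dist s t powr p \<le> C" if "s \<in> \<phi> ` S" "t \<in> \<phi> ` S" for s t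
        using that p c0 dist_le unfolding C_def
        by (auto simp: \<phi>_dist intro!: powr_mono2 mult_left_mono)
      show "C \<le> dist_diagonal s powr p" if "s \<in> \<phi> ` S" for s
        using that p c0 M(1) \<phi>_diag(1) unfolding C_def by (auto intro!: powr_mono2)
    qed (use m in \<open>simp add: f_def\<close>)
    then obtain w where w: "(\<lambda>s t. w (\<phi> s) (\<phi> t)) \<in> transport_plans S (cell_mass T \<alpha>) (cell_mass T \<beta>)"
      "transport_cost p S (\<lambda>s t. w (\<phi> s) (\<phi> t)) \<le> ?c powr p + C * K"
      unfolding cost card Bex_def plans by blast
    \<comment> \<open>Superadditivity of the p-th power absorbs the rounding error into a shift of
      the cost by \<delta>.\<close>
    have "?c powr p + C * K \<le> (?c + \<delta>) powr p"
      using CK powr_add_ge[OF p matching_cost_nonneg, of \<delta> p "f \<alpha>" "f \<beta>" m] \<delta> by simp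
    with w(2) have tc: "transport_cost p S (\<lambda>s t. w (\<phi> s) (\<phi> t)) \<le> (?c + \<delta>) powr p" by linarith
    have pos: "0 < ?c + \<delta>" using \<delta> by (intro add_nonneg_pos matching_cost_nonneg)
    obtain \<gamma> where \<gamma>: "\<gamma> \<in> couplings \<alpha> \<beta>"
      "(\<integral>\<^sup>+ z. ennreal (linf_dist (fst z) (snd z) powr p) \<partial>\<gamma>) \<le> ennreal ((?c + \<delta> + 2 * \<eta>) powr p)"
      using transport_plan_to_coupling[OF p \<eta> pos prob[OF A(1)] prob[OF A(2)] err[OF A(1)] err[OF A(2)] w(1) tc]
      by blast
    have "wasserstein_measure p \<alpha> \<beta> \<le> ?c + \<delta> + 2 * \<eta>"
      using pos \<eta> by (intro wasserstein_measure_le[OF p _ \<gamma>]) simp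
    then show "wasserstein_measure p \<alpha> \<beta> - \<epsilon> \<le> ?c"
      using assms(4) by (simp add: \<eta>_def \<delta>_def)
  qed
  \<comment> \<open>Conversely, a nearly optimal coupling is quantized to a plan on
    \<open>S\<close>, carried to the scaled points and rounded to a matching.\<close>
  moreover have "wasserstein_diagram p (f \<alpha>) (f \<beta>) \<le> wasserstein_measure p \<alpha> \<beta> + \<epsilon>"
    if A: "\<alpha> \<in> A" "\<beta> \<in> A" for \<alpha> \<beta>
  proof -
    let ?W = "wasserstein_measure p \<alpha> \<beta>"
    have W0: "0 \<le> ?W" by (simp add: wasserstein_measure_def)
    obtain \<gamma>0 where "\<gamma>0 \<in> couplings \<alpha> \<beta>"
      "(\<integral>\<^sup>+ z. ennreal (linf_dist (fst z) (snd z) powr p) \<partial>\<gamma>0) < \<infinity>"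
      using ex_finite_cost_coupling[OF p \<eta> prob[OF A(1)] prob[OF A(2)] err[OF A(1)] err[OF A(2)]] by blast
    then obtain \<gamma> where \<gamma>: "\<gamma> \<in> couplings \<alpha> \<beta>"
      "(\<integral>\<^sup>+ z. ennreal (linf_dist (fst z) (snd z) powr p) \<partial>\<gamma>) \<le> ennreal ((?W + \<delta>) powr p)"
      using wasserstein_measure_approx[OF p \<delta>] by blast
    have pos: "0 < ?W + \<delta>" using W0 \<delta> by simp
    obtain w where w: "w \<in> transport_plans S (cell_mass T \<alpha>) (cell_mass T \<beta>)"
      "transport_cost p S w \<le> (?W + \<delta> + 2 * \<eta>) powr p"
      using coupling_to_transport_plan[OF p \<eta> pos \<gamma>(1) err[OF A(1)] err[OF A(2)] \<gamma>(2)] by blast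
    have "(\<lambda>s t. w (\<psi> s) (\<psi> t)) \<in> transport_plans (\<phi> ` S) (mass \<alpha>) (mass \<beta>)"
      unfolding plans \<psi>\<phi> by (rule w(1))
    then have "\<exists>m\<in>partial_matchings (f \<alpha>) (f \<beta>). matching_cost p (f \<alpha>) (f \<beta>) m powr p
        \<le> real N * transport_cost p (\<phi> ` S) (\<lambda>s t. w (\<psi> s) (\<psi> t)) + 2 * (H * (real (card (\<phi> ` S)))\<^sup>2)"
      unfolding f_def
    proof (rule transport_plan_to_matching[OF p S' mass1[OF A(1)] mass1[OF A(2)] _ CH(2), rotated])
      show "dist_diagonal s powr p \<le> H" if "s \<in> \<phi> ` S" for s
        using that p \<phi>_diag(2) unfolding H_def by (auto simp: dist_diagonal_eq intro!: powr_mono2)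
    qed
    then obtain m where m: "m \<in> partial_matchings (f \<alpha>) (f \<beta>)"
      "matching_cost p (f \<alpha>) (f \<beta>) m powr p \<le> transport_cost p S w + 2 * (H * K\<^sup>2)"
      unfolding cost card \<psi>\<phi> by blast
    have "(?W + \<delta> + 2 * \<eta>) powr p + \<delta> powr p \<le> (?W + \<delta> + 2 * \<eta> + \<delta>) powr p"
      using W0 \<delta> \<eta> by (intro powr_add_ge[OF p]) auto
    then have "matching_cost p (f \<alpha>) (f \<beta>) m powr p \<le> (?W + \<delta> + 2 * \<eta> + \<delta>) powr p"
      using m(2) w(2) HK by linarith
    then have "matching_cost p (f \<alpha>) (f \<beta>) m \<le> ?W + \<delta> + 2 * \<eta> + \<delta>"
      using p W0 \<delta> \<eta> powr_less_mono2[of p "?W + \<delta> + 2 * \<eta> + \<delta>" "matching_cost p (f \<alpha>) (f \<beta>) m"]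
      by (force simp: not_le[symmetric])
    then show ?thesis
      using wasserstein_diagram_le[OF m(1), of p] assms(4) by (simp add: \<eta>_def \<delta>_def)
  qed
  ultimately show ?thesis by (intro exI[of _ f]) blast
qed

end
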